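(* Let $\Gamma$ be a smooth closed convex curve in $\mathbb{R}^2$ with a fixed orientation which is not a circle. Then for all but finitely many admissible values of the magnitude $\beta$ of the magnetic field, the outer magnetic billiard of $\Gamma$ is not algebraically integrable, i.e. there is no non-constant polynomial $F$ invariant under the outer magnetic billiard map $T$ of $\Gamma$. Here the admissible values are all $\beta>0$ if $\Gamma$ is oriented clockwise, and all $\beta$ with $0<\beta<k_{\min}$ (the minimal curvature of $\Gamma$) if $\Gamma$ is oriented counterclockwise.
   Context: Let $r=1/\beta$, let $J$ be rotation of $\mathbb{R}^2$ by $+90^\circ$, $s$ an arc-length parameter on $\Gamma$ agreeing with the fixed orientation, $\tau(s)=\dot\Gamma(s)$, and $\Gamma_{+2r}(s)=\Gamma(s)+2rJ\tau(s)$. A Larmor circle is a circle of radius $r$ oriented counterclockwise; the Larmor circle tangent to $\Gamma$ at $\Gamma(s)$ with agreed orientation is the one centered at $\Gamma(s)+rJ\tau(s)$. Outer magnetic billiard map $T$: it acts on the annulus $A$ bounded by $\Gamma$ and $\Gamma_{+2r}$. Given $P\in A$, take the Larmor circle starting from $P$ and tangent to $\Gamma$ at a point $\Gamma(s)$ with agreed orientation, where the counterclockwise arc from $P$ to $\Gamma(s)$ has angular measure in $(0,\pi)$; then $T(P)$ is the point on the same Larmor circle such that the (counterclockwise) arcs $(P;\Gamma(s))$ and $(\Gamma(s);T(P))$ have the same angular measure. If $\Gamma$ is oriented clockwise, $T$ is well defined for every $\beta>0$; if counterclockwise, for $0<\beta<k_{\min}$. A polynomial $F$ in the plane coordinates is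 invariant under $T$ if $F(T(P))=F(P)$ for all $P\in A$. *)

theory Defs
  imports "HOL-Complex_Analysis.Complex_Analysis"
begin

text \<open>
  The Euclidean plane is modelled by \<^typ>\<open>complex\<close>, so that the rotation J by +90 degrees is
  multiplication by \<open>\<i>\<close>. A closed curve is given as a function on the whole real line that is
  periodic with period its length \<open>L\<close>; the orientation of the curve is the one induced by the
  parametrization.
\<close>

definition smooth_curve :: "(real \<Rightarrow> complex) \<Rightarrow> bool" where
  "smooth_curve \<gamma> \<longleftrightarrow>
    (\<exists>D. D 0 = \<gamma> \<and> (\<forall>n s. (D n has_vector_derivative D (Suc n) s) (at s)))"

definition tangent :: "(real \<Rightarrow> complex) \<Rightarrow> real \<Rightarrow> complex" where
  "tangent \<gamma> s = vector_derivative \<gamma> (at s)"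

definition unit_interval_loop :: "(real \<Rightarrow> complex) \<Rightarrow> real \<Rightarrow> real \<Rightarrow> complex" where
  "unit_interval_loop \<gamma> L = (\<lambda>t. \<gamma> (L * t))"

text \<open>
  Convexity is that of the closed region bounded by the curve; points and arcs of zero curvature
  are allowed.
\<close>

definition smooth_closed_convex_curve :: "(real \<Rightarrow> complex) \<Rightarrow> real \<Rightarrow> bool" where
  "smooth_closed_convex_curve \<gamma> L \<longleftrightarrow>
    L > 0 \<and> (\<forall>s. \<gamma> (s + L) = \<gamma> s) \<and>
    smooth_curve \<gamma> \<and> (\<forall>s. norm (tangent \<gamma> s) = 1) \<and>
    simple_path (unit_interval_loop \<gamma> L) \<and>
    convex (range \<gamma> \<union> inside (range \<gamma>))"

definition counterclockwise :: "(real \<Rightarrow> complex) \<Rightarrow> real \<Rightarrow> bool" where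
  "counterclockwise \<gamma> L \<longleftrightarrow>
    (\<forall>z \<in> inside (range \<gamma>). winding_number (unit_interval_loop \<gamma> L) z = 1)"

definition clockwise :: "(real \<Rightarrow> complex) \<Rightarrow> real \<Rightarrow> bool" where
  "clockwise \<gamma> L \<longleftrightarrow>
    (\<forall>z \<in> inside (range \<gamma>). winding_number (unit_interval_loop \<gamma> L) z = -1)"

text \<open>
  The unsigned curvature; the formula presupposes parametrization by arc length.
\<close>

definition curvature :: "(real \<Rightarrow> complex) \<Rightarrow> real \<Rightarrow> real" where
  "curvature \<gamma> s = norm (vector_derivative (tangent \<gamma>) (at s))"

definition min_curvature :: "(real \<Rightarrow> complex) \<Rightarrow> real" where
  "min_curvature \<gamma> = (INF s. curvature \<gamma> s)"

definition admissible_fields :: "(real \<Rightarrow> complex) \<Rightarrow> real \<Rightarrow> real set" where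
  "admissible_fields \<gamma> L =
    {\<beta>. 0 < \<beta> \<and> (clockwise \<gamma> L \<or> counterclockwise \<gamma> L \<and> \<beta> < min_curvature \<gamma>)}"

definition parallel_curve :: "(real \<Rightarrow> complex) \<Rightarrow> real \<Rightarrow> real \<Rightarrow> complex" where
  "parallel_curve \<gamma> d s = \<gamma> s + of_real d * \<i> * tangent \<gamma> s"

text \<open>
  For admissible \<open>\<beta>\<close>, with \<open>r = 1 / \<beta>\<close>, the parallel curve at signed distance \<open>2 r\<close> encloses the
  original curve for both orientations. The annulus is taken to be open: on its two boundary
  curves the arc from P to the point of tangency would have measure 0 or \<open>\<pi>\<close>.
\<close>

definition billiard_annulus :: "(real \<Rightarrow> complex) \<Rightarrow> real \<Rightarrow> complex set" where
  "billiard_annulus \<gamma> \<beta> =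
    inside (range (parallel_curve \<gamma> (2 * (1 / \<beta>)))) \<inter> outside (range \<gamma>)"

definition larmor_center :: "(real \<Rightarrow> complex) \<Rightarrow> real \<Rightarrow> real \<Rightarrow> complex" where
  "larmor_center \<gamma> \<beta> s = parallel_curve \<gamma> (1 / \<beta>) s"

text \<open>
  The point reached from \<open>\<gamma> s\<close> by moving counterclockwise through the signed angle \<open>\<theta>\<close> along the
  Larmor circle tangent to the curve at \<open>\<gamma> s\<close>.
\<close>

definition larmor_point :: "(real \<Rightarrow> complex) \<Rightarrow> real \<Rightarrow> real \<Rightarrow> real \<Rightarrow> complex" where
  "larmor_point \<gamma> \<beta> s \<theta> =
    larmor_center \<gamma> \<beta> s + cis \<theta> * (\<gamma> s - larmor_center \<gamma> \<beta> s)"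

definition outer_billiard_map :: "(real \<Rightarrow> complex) \<Rightarrow> real \<Rightarrow> complex \<Rightarrow> complex" where
  "outer_billiard_map \<gamma> \<beta> P =
    (THE Q. \<exists>s \<theta>. 0 < \<theta> \<and> \<theta> < pi \<and>
        P = larmor_point \<gamma> \<beta> s (- \<theta>) \<and> Q = larmor_point \<gamma> \<beta> s \<theta>)"

definition invariant_function :: "(real \<Rightarrow> complex) \<Rightarrow> real \<Rightarrow> (complex \<Rightarrow> real) \<Rightarrow> bool" where
  "invariant_function \<gamma> \<beta> F \<longleftrightarrow>
    (\<forall>P \<in> billiard_annulus \<gamma> \<beta>. F (outer_billiard_map \<gamma> \<beta> P) = F P)"

text \<open>
  On \<^typ>\<open>complex\<close>, \<^const>\<open>real_polynomial_function\<close> describes exactly the real polynomials in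
  the two plane coordinates \<^const>\<open>Re\<close> and \<^const>\<open>Im\<close>.
\<close>

definition algebraically_integrable :: "(real \<Rightarrow> complex) \<Rightarrow> real \<Rightarrow> bool" where
  "algebraically_integrable \<gamma> \<beta> \<longleftrightarrow>
    (\<exists>F. real_polynomial_function F \<and> \<not> F constant_on UNIV \<and> invariant_function \<gamma> \<beta> F)"

end

theory Submission
  imports Defs "Jordan_Normal_Form.Char_Poly" "HOL-Computational_Algebra.Field_as_Ring"
begin

text \<open>
  Invariance of \<open>F\<close> means that \<open>F\<close> is even, as a function of the angle from the tangency point, on
  every Larmor circle. Hence \<open>F\<close> is constant on the curve, which is therefore locally algebraic;
  let \<open>f\<close> be a minimal polynomial of a small arc and write \<open>F - const = f\<^sup>p g\<close>. With \<open>w\<close> the normal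
  derivative of \<open>f\<close> and \<open>k\<close> the signed curvature, the lowest odd Taylor coefficient gives
  \<open>((\<beta> - k) w\<^sup>3)\<^sup>p g\<^sup>3 = const \<noteq> 0\<close>. So \<open>1 / (\<beta> - k)\<close> is a polynomial in \<open>x, y, w\<close> on the arc, hence
  integral over the polynomials in \<open>x\<close> up to powers of the leading coefficient \<open>q\<close> of \<open>f\<close>. If
  \<open>M(x, T)\<close> is the primitive minimal polynomial of \<open>k\<close>, this forces \<open>M(x, \<beta>)\<close> to divide a power
  of \<open>q\<close>. When this happens for infinitely many \<open>\<beta>\<close>, \<open>M\<close> cannot depend on \<open>x\<close>, so \<open>k\<close> takes finitely
  many values on the arc. Thus \<open>k' = 0\<close> everywhere and the curve is a circle.
\<close>

subsection \<open>Bivariate polynomials\<close>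

text \<open>The polynomial \<open>F\<close> may change with \<beta>, but the arc, \<open>f\<close>,
  its leading coefficient \<open>q\<close> and \<open>M\<close> do not; this is what lets infinitely
  many \<beta> be played off against a single \<open>q\<close>. Polynomials are kept in R[x][y] with
  the second coordinate as outer variable, so that degree and leading coefficient refer to y and
  pseudo-division takes place over R[x].

  The exponents of the conserved quantity come from Taylor coefficients. On the Larmor circle the
  cubic coefficient of \<open>f\<close> over its quadratic one is r/3 times the logarithmic
  derivative along the curve of (\<beta> - k) w^3; the linear coefficient of \<open>g\<close> over
  its constant one is r times the logarithmic derivative of \<open>g\<close>. Evenness makes p times
  the first plus the second vanish.

  Two obstacles shape the rest. On the arc w need not be a polynomial in x, y, only w^2 = |grad f|^2
  is, so one computes with functions A + B w. And the image point is a definite description, so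
  evenness presupposes that points of the tangent arcs lie in the annulus and determine their image;
  supporting lines give this in the clockwise case, rolling in the other.\<close>

definition eval2 :: "real poly poly \<Rightarrow> real \<Rightarrow> real \<Rightarrow> real" where
  "eval2 p a b = poly (poly p [:b:]) a"

lemma eval2_simps [simp]:
  "eval2 0 a b = 0"
  "eval2 1 a b = 1"
  "eval2 (p + q) a b = eval2 p a b + eval2 q a b"
  "eval2 (p - q) a b = eval2 p a b - eval2 q a b"
  "eval2 (- p) a b = - eval2 p a b"
  "eval2 (p * q) a b = eval2 p a b * eval2 q a b"
  "eval2 (p ^ n) a b = eval2 p a b ^ n"
  "eval2 (Polynomial.smult c p) a b = poly c a * eval2 p a b"
  "eval2 (pCons c p) a b = poly c a + b * eval2 p a b"
  by (simp_all add: eval2_def)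

lemma eval2_sum [simp]: "eval2 (sum f A) a b = (\<Sum>i\<in>A. eval2 (f i) a b)"
  by (induction A rule: infinite_finite_induct) auto

lemma eval2_altdef: "eval2 p a b = (\<Sum>i\<le>degree p. poly (coeff p i) a * b ^ i)"
  by (simp add: eval2_def poly_altdef[of p] poly_sum poly_power)

lemma eval2_degree_0: "degree p = 0 \<Longrightarrow> eval2 p a b = poly (coeff p 0) a"
  by (simp add: eval2_altdef)

section \<open>Gauss's lemma and specialization of the outer variable\<close>

text \<open>Content is multiplicative, so the scalar \<open>a\<close> passes entirely into the
  content of the cofactor and can be divided out there. Pseudo-division yields divisibility only for
  such scalar multiples, which is where this is used.\<close>

lemma content_1_dvd_smult_cancel:
  fixes M h :: "'a :: {factorial_ring_gcd,semiring_gcd_mult_normalize} poly"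
  assumes "content M = 1" "a \<noteq> 0" "M dvd Polynomial.smult a h"
  shows "M dvd h"
proof -
  obtain q where q: "Polynomial.smult a h = M * q" using assms(3) unfolding dvd_def by blast
  have "content (Polynomial.smult a h) = content q" using q assms(1) by (simp add: content_mult)
  hence "normalize a * content h = content q" by simp
  hence "normalize a dvd content q" by (metis dvd_triv_left)
  hence "a dvd content q" by simp
  hence "[:a:] dvd q" by (simp add: const_poly_dvd_iff_dvd_content)
  then obtain q' where "q = [:a:] * q'" by auto
  hence "Polynomial.smult a h = Polynomial.smult a (M * q')" using q by simp
  hence "h = M * q'" using assms(2) by (simp add: poly_eq_iff)
  thus ?thesis by simp
qed

lemma poly_map_poly_const: "poly (map_poly (\<lambda>c. [:c:]) N) [:b:] = [:poly N b:]"
  for N :: "real poly"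
  by (induction N) (simp_all add: map_poly_pCons)

text \<open>
  Only the finitely many prime divisors of \<open>q\<close> can divide infinitely many of the specializations
  \<open>M(x, \<beta>)\<close>, and a prime dividing infinitely many of them divides \<open>M\<close>.
\<close>

lemma specializations_dvd_power_imp_const:
  fixes M :: "real poly poly" and q :: "real poly"
  assumes "infinite B" "content M = 1" "q \<noteq> 0"
    and dvd: "\<And>\<beta>. \<beta> \<in> B \<Longrightarrow> \<exists>n. poly M [:\<beta>:] dvd q ^ n"
  obtains N where "M = map_poly (\<lambda>c. [:c:]) N"
proof -
  define C where "C \<pi> = {\<beta>\<in>B. \<pi> dvd poly M [:\<beta>:]}" for \<pi>
  \<comment> \<open>Reduction mod \<pi> is linear over the reals, so for fixed i the i-th
    coefficient of M(x, \<beta>) mod \<pi> is itself a real polynomial in \<beta>: it is zero or has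
    finitely many roots.\<close>
  have *: "poly (map_poly (\<lambda>c. coeff (c mod \<pi>) i) M) \<beta> = coeff (poly M [:\<beta>:] mod \<pi>) i" for \<pi> i \<beta>
  proof (induction M)
    case (pCons c M)
    have "(c + Polynomial.smult \<beta> (poly M [:\<beta>:])) mod \<pi> = c mod \<pi> + Polynomial.smult \<beta> (poly M [:\<beta>:] mod \<pi>)"
      by (simp add: poly_mod_add_left mod_smult_left)
    with pCons show ?case by (simp add: map_poly_pCons)
  qed auto
  have fin: "finite (C \<pi>)" if "prime \<pi>" for \<pi>
  proof (rule ccontr)
    assume inf: "infinite (C \<pi>)"
    have "map_poly (\<lambda>c. coeff (c mod \<pi>) i) M = 0" for i
    proof (rule ccontr)
      assume "map_poly (\<lambda>c. coeff (c mod \<pi>) i) M \<noteq> 0"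
      from poly_roots_finite[OF this] have "finite {\<beta>. coeff (poly M [:\<beta>:] mod \<pi>) i = 0}"
        by (simp add: *)
      moreover have "C \<pi> \<subseteq> {\<beta>. coeff (poly M [:\<beta>:] mod \<pi>) i = 0}"
        by (auto simp: C_def)
      ultimately show False using inf finite_subset by blast
    qed
    hence "coeff (coeff M j mod \<pi>) i = 0" for i j
      by (metis coeff_0 coeff_map_poly mod_0)
    hence "coeff M j mod \<pi> = 0" for j by (simp add: poly_eq_iff)
    hence "[:\<pi>:] dvd M" by (auto simp: const_poly_dvd_iff)
    hence "\<pi> dvd content M" by (simp add: const_poly_dvd_iff_dvd_content)
    thus False using assms(2) that by (metis not_prime_unit)
  qed
  have "finite (\<Union>\<pi>\<in>prime_factors q. C \<pi>)" using fin by auto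
  hence inf: "infinite (B - (\<Union>\<pi>\<in>prime_factors q. C \<pi>))" using assms(1) by simp
  \<comment> \<open>Off the exceptional sets every prime divisor of M(x, \<beta>) would divide q and
    hence be one of the excluded \<pi>.\<close>
  have unit: "is_unit (poly M [:\<beta>:])" if \<beta>: "\<beta> \<in> B - (\<Union>\<pi>\<in>prime_factors q. C \<pi>)" for \<beta>
  proof (rule ccontr)
    assume nu: "\<not> is_unit (poly M [:\<beta>:])"
    obtain n where n: "poly M [:\<beta>:] dvd q ^ n" using dvd \<beta> by blast
    hence "poly M [:\<beta>:] \<noteq> 0" using \<open>q \<noteq> 0\<close> by auto
    then obtain \<pi> where \<pi>: "\<pi> dvd poly M [:\<beta>:]" "prime \<pi>" using nu prime_divisor_exists by blast
    hence "\<pi> dvd q" using n prime_dvd_power dvd_trans by blast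
    hence "\<pi> \<in> prime_factors q" using \<pi> \<open>q \<noteq> 0\<close> by (simp add: in_prime_factors_iff)
    thus False using \<beta> \<pi> by (auto simp: C_def)
  qed
  have **: "poly (map_poly (\<lambda>c. coeff c i) M) \<beta> = coeff (poly M [:\<beta>:]) i" for i \<beta>
    by (induction M) (auto simp: map_poly_pCons)
  \<comment> \<open>A unit of R[x] is a constant, so for i > 0 the coefficient of x^i in M(x,
    \<beta>), a polynomial in \<beta>, has infinitely many roots.\<close>
  have "coeff (coeff M j) i = 0" if "i > 0" for i j
  proof -
    have "map_poly (\<lambda>c. coeff c i) M = 0"
    proof (rule ccontr)
      assume "map_poly (\<lambda>c. coeff c i) M \<noteq> 0"
      from poly_roots_finite[OF this] have "finite {\<beta>. coeff (poly M [:\<beta>:]) i = 0}"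
        by (simp add: **)
      moreover have "B - (\<Union>\<pi>\<in>prime_factors q. C \<pi>) \<subseteq> {\<beta>. coeff (poly M [:\<beta>:]) i = 0}"
      proof
        fix \<beta> assume "\<beta> \<in> B - (\<Union>\<pi>\<in>prime_factors q. C \<pi>)"
        from unit[OF this] have "degree (poly M [:\<beta>:]) = 0" by (simp add: is_unit_iff_degree poly_dvd_1)
        thus "\<beta> \<in> {\<beta>. coeff (poly M [:\<beta>:]) i = 0}" using \<open>i > 0\<close> by (simp add: coeff_eq_0)
      qed
      ultimately show False using inf finite_subset by blast
    qed
    thus ?thesis by (metis coeff_0 coeff_map_poly)
  qed
  hence "M = map_poly (\<lambda>c. [:c:]) (map_poly (\<lambda>c. coeff c 0) M)"
    by (auto simp: poly_eq_iff coeff_map_poly coeff_pCons split: nat.splits)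
  thus ?thesis using that by blast
qed

subsection \<open>Local minimal polynomials\<close>

definition vanishes_on :: "real poly poly \<Rightarrow> (real \<Rightarrow> real) \<Rightarrow> (real \<Rightarrow> real) \<Rightarrow> real \<Rightarrow> real \<Rightarrow> bool" where
  "vanishes_on h x v a b \<longleftrightarrow> (\<forall>s\<in>{a<..<b}. eval2 h (x s) (v s) = 0)"

lemma vanishes_on_subset:
  "vanishes_on h x v a b \<Longrightarrow> a \<le> a' \<Longrightarrow> b' \<le> b \<Longrightarrow> vanishes_on h x v a' b'"
  by (auto simp: vanishes_on_def)

text \<open>
  The minimum is taken over all subintervals as well, so that vanishing on an arbitrarily small
  piece of the resulting interval already forces divisibility.
\<close>

lemma subinterval_avoiding_finite:
  fixes a b :: real
  assumes "a < b" "finite S"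
  obtains a' b' where "a \<le> a'" "a' < b'" "b' \<le> b" "{a'<..<b'} \<inter> S = {}"
proof -
  \<comment> \<open>The first point of S to the right of a, or b if there is none before it; the
    left end stays at a.\<close>
  define b' where "b' = Min (insert b (S \<inter> {a<..<b}))"
  have fin: "finite (insert b (S \<inter> {a<..<b}))" using assms by simp
  have "a < b'" "b' \<le> b" unfolding b'_def using assms by auto
  moreover have "{a<..<b'} \<inter> S = {}"
  proof -
    have False if "s \<in> S" "a < s" "s < b'" for s
    proof -
      have "s \<in> insert b (S \<inter> {a<..<b})" using that \<open>b' \<le> b\<close> by auto
      from Min_le[OF fin this] show False using that by (simp add: b'_def)
    qed
    thus ?thesis by auto
  qed
  ultimately show ?thesis using that[of a b'] by auto
qed

text \<open>Pseudo-dividing an annihilator by one of least degree leaves a remainder that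
  annihilates on the same subinterval, so it is 0, and Gauss's lemma removes the scalar. Applied
  with v = y for the defining polynomial of an arc, and with v = k for the relation between abscissa
  and curvature.\<close>

lemma local_minimal_polynomial:
  fixes x v :: "real \<Rightarrow> real" and h0 :: "real poly poly"
  assumes "a < b" "inj_on x {a<..<b}" "h0 \<noteq> 0" "vanishes_on h0 x v a b"
  obtains M a' b' where "a \<le> a'" "a' < b'" "b' \<le> b" "content M = 1" "vanishes_on M x v a' b'"
    "\<And>h c d. a' \<le> c \<Longrightarrow> c < d \<Longrightarrow> d \<le> b' \<Longrightarrow> vanishes_on h x v c d \<Longrightarrow> M dvd h"
proof -
  define P where "P n \<longleftrightarrow> (\<exists>h c d. a \<le> c \<and> c < d \<and> d \<le> b \<and> h \<noteq> 0 \<and> vanishes_on h x v c d \<and> degree h = n)" for n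
  have "P (degree h0)" unfolding P_def using assms by blast
  hence PL: "P (LEAST n. P n)" by (rule LeastI)
  then obtain h c d where h: "a \<le> c" "c < d" "d \<le> b" "h \<noteq> 0" "vanishes_on h x v c d" "degree h = (LEAST n. P n)"
    unfolding P_def by blast
  define k where "k = content h"
  define M where "M = primitive_part h"
  have hM: "h = Polynomial.smult k M" by (simp add: k_def M_def content_times_primitive_part)
  have k0: "k \<noteq> 0" using h(4) by (simp add: k_def)
  have degM: "degree M = (LEAST n. P n)" using h(6) hM k0 by simp
  have M0: "M \<noteq> 0" using hM h(4) by auto
  have cM: "content M = 1" using h(4) by (simp add: M_def)
  \<comment> \<open>Where the content vanishes, h may vanish without M doing so; injectivity of x
    leaves finitely many such points.\<close>
  define S where "S = {s\<in>{a<..<b}. poly k (x s) = 0}"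
  have "finite S"
  proof (rule finite_imageD)
    show "finite (x ` S)" by (rule finite_subset[OF _ poly_roots_finite[OF k0]]) (auto simp: S_def)
    show "inj_on x S" using assms(2) by (rule inj_on_subset) (auto simp: S_def)
  qed
  from subinterval_avoiding_finite[OF h(2) this] obtain a' b'
    where ab: "c \<le> a'" "a' < b'" "b' \<le> d" "{a'<..<b'} \<inter> S = {}" .
  have vM: "vanishes_on M x v a' b'"
    unfolding vanishes_on_def
  proof
    fix s assume s: "s \<in> {a'<..<b'}"
    hence "eval2 h (x s) (v s) = 0" using h(5) ab by (auto simp: vanishes_on_def)
    moreover have "s \<notin> S" "s \<in> {a<..<b}" using s ab h by auto
    ultimately show "eval2 M (x s) (v s) = 0" by (auto simp: hM S_def)
  qed
  show ?thesis
  proof (rule that[OF _ ab(2) _ cM vM])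
    show "a \<le> a'" "b' \<le> b" using ab h by auto
    fix g e f assume ef: "a' \<le> e" "e < f" "f \<le> b'" "vanishes_on g x v e f"
    obtain q r where qr: "pseudo_divmod g M = (q, r)" by (cases "pseudo_divmod g M")
    define l where "l = lead_coeff M ^ (Suc (degree g) - degree M)"
    have l: "Polynomial.smult l g = M * q + r" and r: "r = 0 \<or> degree r < degree M"
      using pseudo_divmod[OF M0 qr] by (simp_all add: l_def)
    have "vanishes_on r x v e f"
      unfolding vanishes_on_def
    proof
      fix s assume s: "s \<in> {e<..<f}"
      have "eval2 g (x s) (v s) = 0" "eval2 M (x s) (v s) = 0"
        using s ef vM by (auto simp: vanishes_on_def)
      moreover have "eval2 (Polynomial.smult l g) (x s) (v s) = eval2 (M * q + r) (x s) (v s)" by (simp only: l)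
      ultimately show "eval2 r (x s) (v s) = 0" by simp
    qed
    moreover have "a \<le> e" "f \<le> b" using ef ab h by auto
    ultimately have "r = 0 \<or> P (degree r)" using ef(2) unfolding P_def by blast
    hence "r = 0" using r degM not_less_Least by metis
    hence "M dvd Polynomial.smult l g" using l by simp
    thus "M dvd g" using content_1_dvd_smult_cancel[OF cM, of l g] M0 by (simp add: l_def)
  qed
qed

subsection \<open>Integrality\<close>

lemma eval2_conv_map_poly: "eval2 p a b = poly (map_poly (\<lambda>c. poly c a) p) b"
  by (induction p) (simp_all add: map_poly_pCons eval2_def)

text \<open>Multiplying a remainder by a further power of the leading coefficient keeps its y-degree
  below that of f, so exponents can be raised and one N serves a finite family. The common N gives
  all rows of the matrix in the next lemma the same eigenvalue.\<close>

lemma common_pseudo_remainder: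
  fixes f :: "real poly poly"
  assumes "degree f > 0" "finite Z"
  shows "\<exists>N. \<forall>A\<in>Z. \<exists>R. degree R < degree f \<and> f dvd Polynomial.smult (lead_coeff f ^ N) A - R"
  using assms(2)
proof (induction Z rule: finite_induct)
  case (insert A Z)
  then obtain N where N: "\<forall>A\<in>Z. \<exists>R. degree R < degree f \<and> f dvd Polynomial.smult (lead_coeff f ^ N) A - R"
    by blast
  have f0: "f \<noteq> 0" using assms(1) by auto
  obtain q r where qr: "pseudo_divmod A f = (q, r)" by (cases "pseudo_divmod A f")
  define n where "n = Suc (degree A) - degree f"
  have "Polynomial.smult (lead_coeff f ^ n) A = f * q + r" "degree r < degree f"
    using pseudo_divmod[OF f0 qr] assms(1) by (auto simp: n_def)
  hence A: "\<exists>n R. degree R < degree f \<and> f dvd Polynomial.smult (lead_coeff f ^ n) A - R"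
    by (intro exI[of _ n] exI[of _ r]) auto
  have mono: "\<exists>R. degree R < degree f \<and> f dvd Polynomial.smult (lead_coeff f ^ (n + m)) B - R"
    if ex: "\<exists>R. degree R < degree f \<and> f dvd Polynomial.smult (lead_coeff f ^ n) B - R" for n m B
  proof -
    obtain R where R: "degree R < degree f" "f dvd Polynomial.smult (lead_coeff f ^ n) B - R" using ex by blast
    have "f dvd Polynomial.smult (lead_coeff f ^ m) (Polynomial.smult (lead_coeff f ^ n) B - R)"
      using R(2) by (rule dvd_smult)
    also have "\<dots> = Polynomial.smult (lead_coeff f ^ (n + m)) B - Polynomial.smult (lead_coeff f ^ m) R"
      by (simp add: smult_diff_right power_add mult.commute)
    finally have "f dvd Polynomial.smult (lead_coeff f ^ (n + m)) B - Polynomial.smult (lead_coeff f ^ m) R" .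
    moreover have "degree (Polynomial.smult (lead_coeff f ^ m) R) < degree f" using R(1) f0 by simp
    ultimately show ?thesis by blast
  qed
  from A obtain n where "\<exists>R. degree R < degree f \<and> f dvd Polynomial.smult (lead_coeff f ^ n) A - R" by blast
  from mono[OF this, of N] mono[of N _ n] N show ?case
    by (intro exI[of _ "n + N"]) (auto simp: add.commute)
qed auto

text \<open>
  The functions \<open>y\<^sup>i\<close> and \<open>y\<^sup>i w\<close> with \<open>i < degree f\<close> span a module stable under multiplication by
  \<open>q\<^sup>N u\<close>, which is therefore an eigenvalue of a matrix with polynomial entries in \<open>x\<close>.
\<close>

lemma integral_up_to_leading_coefficient:
  fixes f A B E :: "real poly poly" and x y w u :: "'a \<Rightarrow> real"
  assumes deg: "degree f > 0"
    and f: "\<And>s. s \<in> I \<Longrightarrow> eval2 f (x s) (y s) = 0"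
    and w: "\<And>s. s \<in> I \<Longrightarrow> w s ^ 2 = eval2 E (x s) (y s)"
    and u: "\<And>s. s \<in> I \<Longrightarrow> u s = eval2 A (x s) (y s) + eval2 B (x s) (y s) * w s"
  obtains c N where "lead_coeff c = 1"
    "\<And>s. s \<in> I \<Longrightarrow> eval2 c (x s) (poly (lead_coeff f) (x s) ^ N * u s) = 0"
proof -
  define d where "d = degree f"
  define Y :: "real poly poly" where "Y = [:0, 1:]"
  \<comment> \<open>u times the k-th generator is \<open>PA k\<close> + \<open>PB k\<close> * w. The
    first d generators are powers of y, the other d carry a factor w, and w^2 has been replaced by
    E.\<close>
  define PA where "PA k = (if k < d then A * Y ^ k else B * E * Y ^ (k - d))" for k
  define PB where "PB k = (if k < d then B * Y ^ k else A * Y ^ (k - d))" for k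
  define b where "b s k = (if k < d then y s ^ k else y s ^ (k - d) * w s)" for s k
  have Y: "eval2 Y s t = t" for s t by (simp add: Y_def)
  have ub: "u s * b s k = eval2 (PA k) (x s) (y s) + eval2 (PB k) (x s) (y s) * w s" if "s \<in> I" for s k
    using w[OF that] by (simp add: u[OF that] b_def PA_def PB_def Y algebra_simps power2_eq_square)
  have "finite (PA ` {..<2*d} \<union> PB ` {..<2*d})" by simp
  from common_pseudo_remainder[OF deg this] obtain N where
    N: "\<And>Z. Z \<in> PA ` {..<2*d} \<union> PB ` {..<2*d} \<Longrightarrow>
      \<exists>R. degree R < d \<and> f dvd Polynomial.smult (lead_coeff f ^ N) Z - R"
    unfolding d_def by blast
  have "\<forall>k<2*d. \<exists>R. degree R < d \<and> f dvd Polynomial.smult (lead_coeff f ^ N) (PA k) - R" using N by auto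
  then obtain RA where RA: "\<And>k. k < 2*d \<Longrightarrow> degree (RA k) < d \<and> f dvd Polynomial.smult (lead_coeff f ^ N) (PA k) - RA k"
    by metis
  have "\<forall>k<2*d. \<exists>R. degree R < d \<and> f dvd Polynomial.smult (lead_coeff f ^ N) (PB k) - R" using N by auto
  then obtain RB where RB: "\<And>k. k < 2*d \<Longrightarrow> degree (RB k) < d \<and> f dvd Polynomial.smult (lead_coeff f ^ N) (PB k) - RB k"
    by metis
  have red: "poly (lead_coeff f) (x s) ^ N * eval2 Z (x s) (y s) = (\<Sum>l<d. poly (coeff R l) (x s) * y s ^ l)"
    if s: "s \<in> I" and R: "degree R < d \<and> f dvd Polynomial.smult (lead_coeff f ^ N) Z - R" for s Z R
  proof -
    obtain g where "Polynomial.smult (lead_coeff f ^ N) Z - R = f * g" using R unfolding dvd_def by blast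
    hence "eval2 (Polynomial.smult (lead_coeff f ^ N) Z - R) (x s) (y s) = eval2 (f * g) (x s) (y s)" by simp
    hence "poly (lead_coeff f) (x s) ^ N * eval2 Z (x s) (y s) = eval2 R (x s) (y s)"
      using f[OF s] by simp
    also have "\<dots> = (\<Sum>l<d. poly (coeff R l) (x s) * y s ^ l)"
      unfolding eval2_altdef using R
      by (intro sum.mono_neutral_left) (auto simp: coeff_eq_0)
    finally show ?thesis .
  qed
  \<comment> \<open>Row k lists the coordinates of \<open>lead_coeff f ^ N\<close> times u times the
    k-th generator: the RA part belongs to y^l, the RB part to y^l w.\<close>
  define M where "M = mat (2*d) (2*d) (\<lambda>(k,l). if l < d then coeff (RA k) l else coeff (RB k) (l - d))"
  have M: "M \<in> carrier_mat (2*d) (2*d)" by (simp add: M_def)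
  show ?thesis
  proof (rule that[of "char_poly M" N])
    show "lead_coeff (char_poly M) = 1" using degree_monic_char_poly[OF M] by simp
    fix s assume s: "s \<in> I"
    define h where "h = (\<lambda>p. poly p (x s))"
    interpret h: comm_ring_hom h by unfold_locales (simp_all add: h_def)
    define Ms where "Ms = map_mat h M"
    have Ms: "Ms \<in> carrier_mat (2*d) (2*d)" using M by (simp add: Ms_def)
    define e where "e = h (lead_coeff f) ^ N * u s"
    define v where "v = vec (2*d) (b s)"
    have "eigenvector Ms v e"
      unfolding eigenvector_def
    proof (intro conjI)
      show "v \<in> carrier_vec (dim_row Ms)" using Ms by (simp add: v_def)
      \<comment> \<open>The generator y^0 = 1 keeps the vector from being zero at every s.\<close>
      have "vec_index v 0 = 1" using deg by (simp add: v_def b_def d_def)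
      moreover have "vec_index (0\<^sub>v (dim_row Ms)) 0 = 0" using Ms deg by (simp add: d_def)
      ultimately show "v \<noteq> 0\<^sub>v (dim_row Ms)" by (metis zero_neq_one)
      show "Ms *\<^sub>v v = e \<cdot>\<^sub>v v"
      proof (rule eq_vecI)
        show "dim_vec (Ms *\<^sub>v v) = dim_vec (e \<cdot>\<^sub>v v)" using Ms by (simp add: v_def)
        fix k assume "k < dim_vec (e \<cdot>\<^sub>v v)"
        hence k: "k < 2*d" by (simp add: v_def)
        have "vec_index (Ms *\<^sub>v v) k = (\<Sum>l<2*d. h (if l < d then coeff (RA k) l else coeff (RB k) (l - d)) * b s l)"
          using k by (simp add: Ms_def M_def v_def scalar_prod_def atLeast0LessThan)
        also have "\<dots> = (\<Sum>l<d. h (coeff (RA k) l) * b s l) + (\<Sum>l=d..<2*d. h (coeff (RB k) (l - d)) * b s l)"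
        proof -
          have "{..<2*d} = {..<d} \<union> {d..<2*d}" "{..<d} \<inter> {d..<2*d} = {}" by auto
          thus ?thesis by (simp add: sum.union_disjoint)
        qed
        also have "(\<Sum>l<d. h (coeff (RA k) l) * b s l) = h (lead_coeff f) ^ N * eval2 (PA k) (x s) (y s)"
          using red[OF s RA[OF k]] by (simp add: h_def b_def)
        also have "(\<Sum>l=d..<2*d. h (coeff (RB k) (l - d)) * b s l) = (\<Sum>l<d. h (coeff (RB k) l) * y s ^ l * w s)"
          by (rule sum.reindex_bij_witness[of _ "\<lambda>l. l + d" "\<lambda>l. l - d"]) (auto simp: b_def)
        also have "\<dots> = h (lead_coeff f) ^ N * eval2 (PB k) (x s) (y s) * w s"
          using red[OF s RB[OF k]] by (simp add: h_def flip: sum_distrib_right)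
        also have "h (lead_coeff f) ^ N * eval2 (PA k) (x s) (y s) + h (lead_coeff f) ^ N * eval2 (PB k) (x s) (y s) * w s
            = e * b s k"
          using arg_cong[OF ub[OF s, of k], of "\<lambda>z. h (lead_coeff f) ^ N * z"]
          by (simp add: e_def ring_distribs mult.assoc)
        finally show "vec_index (Ms *\<^sub>v v) k = vec_index (e \<cdot>\<^sub>v v) k" using k by (simp add: v_def)
      qed
    qed
    hence "eigenvalue Ms e" unfolding eigenvalue_def by blast
    hence "poly (char_poly Ms) e = 0" using eigenvalue_root_char_poly[OF Ms] by blast
    also have "char_poly Ms = map_poly h (char_poly M)" unfolding Ms_def by (rule h.char_poly_hom[OF M])
    finally show "eval2 (char_poly M) (x s) (poly (lead_coeff f) (x s) ^ N * u s) = 0"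
      by (simp add: eval2_conv_map_poly e_def h_def)
  qed
qed

text \<open>A monic relation of degree n for q^N u, where u = 1 / (\<beta> - k), becomes a
  polynomial relation in k after multiplication by (\<beta> - k)^n. Substituting \<beta> for k in it
  leaves only the leading term q^(N n).\<close>

lemma annihilator_of_shifted_inverse:
  fixes f A B E :: "real poly poly" and x y w k :: "'a \<Rightarrow> real"
  assumes deg: "degree f > 0"
    and f: "\<And>s. s \<in> I \<Longrightarrow> eval2 f (x s) (y s) = 0"
    and w: "\<And>s. s \<in> I \<Longrightarrow> w s ^ 2 = eval2 E (x s) (y s)"
    and u: "\<And>s. s \<in> I \<Longrightarrow> (\<beta> - k s) * (eval2 A (x s) (y s) + eval2 B (x s) (y s) * w s) = 1"
  obtains Q N where "poly Q [:\<beta>:] = lead_coeff f ^ N" "\<And>s. s \<in> I \<Longrightarrow> eval2 Q (x s) (k s) = 0"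
proof -
  define q where "q = lead_coeff f"
  define u where "u s = eval2 A (x s) (y s) + eval2 B (x s) (y s) * w s" for s
  have "\<exists>c N. lead_coeff c = 1 \<and> (\<forall>s\<in>I. eval2 c (x s) (poly q (x s) ^ N * u s) = 0)"
    unfolding q_def
    by (rule integral_up_to_leading_coefficient[where I=I, OF deg f w u_def]) (assumption+, blast)
  then obtain c N where c: "lead_coeff c = 1" "\<And>s. s \<in> I \<Longrightarrow> eval2 c (x s) (poly q (x s) ^ N * u s) = 0"
    by blast
  define n where "n = degree c"
  \<comment> \<open>Term i is c_i q^(N i) (\<beta> - T)^(n - i), with
    \<open>[:[:\<beta>:], -1:]\<close> standing for \<beta> - T.\<close>
  define Q where "Q = (\<Sum>i\<le>n. Polynomial.smult (coeff c i * q ^ (N * i)) ([:[:\<beta>:], -1:] ^ (n - i)))"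
  show ?thesis
  proof (rule that[of Q "N * n"])
    have "poly Q [:\<beta>:] = (\<Sum>i\<le>n. coeff c i * q ^ (N * i) * 0 ^ (n - i))"
      by (simp add: Q_def poly_sum poly_power)
    also have "\<dots> = (\<Sum>i\<in>{n}. coeff c i * q ^ (N * i))"
      by (rule sum.mono_neutral_cong_right) (auto simp: power_0_left)
    also have "\<dots> = q ^ (N * n)" using c(1) by (simp add: n_def)
    finally show "poly Q [:\<beta>:] = lead_coeff f ^ (N * n)" by (simp add: q_def)
    fix s assume s: "s \<in> I"
    have 1: "(\<beta> - k s) * u s = 1" using assms(4)[OF s] by (simp add: u_def)
    have "eval2 Q (x s) (k s) = (\<Sum>i\<le>n. poly (coeff c i) (x s) * poly q (x s) ^ (N * i) * (\<beta> - k s) ^ (n - i))"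
      by (simp add: Q_def)
    also have "\<dots> = (\<Sum>i\<le>n. (\<beta> - k s) ^ n * (poly (coeff c i) (x s) * (poly q (x s) ^ N * u s) ^ i))"
    proof (rule sum.cong[OF refl])
      fix i assume "i \<in> {..n}"
      hence "(\<beta> - k s) ^ n * u s ^ i = (\<beta> - k s) ^ (n - i) * ((\<beta> - k s) * u s) ^ i"
        by (simp add: power_mult_distrib flip: power_add mult.assoc)
      thus "poly (coeff c i) (x s) * poly q (x s) ^ (N * i) * (\<beta> - k s) ^ (n - i)
         = (\<beta> - k s) ^ n * (poly (coeff c i) (x s) * (poly q (x s) ^ N * u s) ^ i)"
        using 1 by (simp add: power_mult_distrib power_mult algebra_simps)
    qed
    also have "\<dots> = (\<beta> - k s) ^ n * eval2 c (x s) (poly q (x s) ^ N * u s)"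
      by (simp add: eval2_altdef n_def sum_distrib_left)
    finally show "eval2 Q (x s) (k s) = 0" using c(2)[OF s] by simp
  qed
qed

subsection \<open>Taylor expansion on Larmor circles\<close>

text \<open>The partial derivative in the inner variable x; \<open>pderiv\<close> on the outer level
  is the one in y.\<close>

definition pdx :: "real poly poly \<Rightarrow> real poly poly" where "pdx = map_poly pderiv"

lemma pdx_pCons [simp]: "pdx (pCons c p) = pCons (pderiv c) (pdx p)"
  unfolding pdx_def by (intro poly_eqI) (simp add: coeff_map_poly coeff_pCons split: nat.splits)

lemma pdx_pderiv: "pdx (pderiv p) = pderiv (pdx p)"
  unfolding pdx_def by (intro poly_eqI) (simp add: coeff_map_poly coeff_pderiv pderiv_mult pderiv_of_nat flip: of_nat_Suc)

lemma DERIV_eval2: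
  assumes "(X has_real_derivative X') (at t)" "(Y has_real_derivative Y') (at t)"
  shows "((\<lambda>t. eval2 p (X t) (Y t)) has_real_derivative
    eval2 (pdx p) (X t) (Y t) * X' + eval2 (pderiv p) (X t) (Y t) * Y') (at t)"
proof (induction p)
  case (pCons c p)
  have "((\<lambda>t. poly c (X t)) has_real_derivative poly (pderiv c) (X t) * X') (at t)"
    by (rule DERIV_chain2[OF poly_DERIV assms(1)])
  from DERIV_add[OF this DERIV_mult[OF assms(2) pCons(2)]] show ?case
    by (simp add: pderiv_pCons algebra_simps)
qed (simp add: pdx_def)

text \<open>\<open>jet1\<close>, \<open>jet2\<close>, \<open>jet3\<close> are the chain-rule
  expressions for the first three derivatives of t -> p(X(t), Y(t)), with a1, b1, a2, ... for the
  derivatives of X and Y. As expressions in numbers they can be evaluated on the curve and on a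
  Larmor circle at the same point and compared algebraically.\<close>

definition jet1 where
  "jet1 p a b a1 b1 = eval2 (pdx p) a b * a1 + eval2 (pderiv p) a b * b1"

definition jet2 where
  "jet2 p a b a1 b1 a2 b2 = eval2 (pdx (pdx p)) a b * a1\<^sup>2
     + 2 * eval2 (pdx (pderiv p)) a b * a1 * b1 + eval2 (pderiv (pderiv p)) a b * b1\<^sup>2
     + jet1 p a b a2 b2"

definition jet3 where
  "jet3 p a b a1 b1 a2 b2 a3 b3 = eval2 (pdx (pdx (pdx p))) a b * a1 ^ 3
     + 3 * eval2 (pdx (pdx (pderiv p))) a b * a1\<^sup>2 * b1
     + 3 * eval2 (pdx (pderiv (pderiv p))) a b * a1 * b1\<^sup>2
     + eval2 (pderiv (pderiv (pderiv p))) a b * b1 ^ 3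
     + 3 * (eval2 (pdx (pdx p)) a b * a1 * a2 + eval2 (pdx (pderiv p)) a b * (a1 * b2 + a2 * b1)
            + eval2 (pderiv (pderiv p)) a b * b1 * b2)
     + jet1 p a b a3 b3"

lemma DERIV_jet0:
  assumes "(X has_real_derivative X') (at t)" "(Y has_real_derivative Y') (at t)"
  shows "((\<lambda>t. eval2 p (X t) (Y t)) has_real_derivative jet1 p (X t) (Y t) X' Y') (at t)"
  using DERIV_eval2[OF assms] by (simp add: jet1_def)

lemma DERIV_jet1:
  assumes X: "(X has_real_derivative X1 t) (at t)" and Y: "(Y has_real_derivative Y1 t) (at t)"
    and X1: "(X1 has_real_derivative X2) (at t)" and Y1: "(Y1 has_real_derivative Y2) (at t)"
  shows "((\<lambda>t. jet1 p (X t) (Y t) (X1 t) (Y1 t)) has_real_derivative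
    jet2 p (X t) (Y t) (X1 t) (Y1 t) X2 Y2) (at t)"
  unfolding jet1_def jet2_def
  by (rule derivative_eq_intros DERIV_eval2 assms refl)+
     (simp add: algebra_simps power2_eq_square pdx_pderiv)

lemma DERIV_jet2:
  assumes X: "(X has_real_derivative X1 t) (at t)" and Y: "(Y has_real_derivative Y1 t) (at t)"
    and X1: "(X1 has_real_derivative X2 t) (at t)" and Y1: "(Y1 has_real_derivative Y2 t) (at t)"
    and X2: "(X2 has_real_derivative X3) (at t)" and Y2: "(Y2 has_real_derivative Y3) (at t)"
  shows "((\<lambda>t. jet2 p (X t) (Y t) (X1 t) (Y1 t) (X2 t) (Y2 t)) has_real_derivative
    jet3 p (X t) (Y t) (X1 t) (Y1 t) (X2 t) (Y2 t) X3 Y3) (at t)"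
  unfolding jet1_def jet2_def jet3_def
  by (rule derivative_eq_intros DERIV_eval2 assms refl)+
     (simp add: algebra_simps power2_eq_square power3_eq_cube pdx_pderiv)

text \<open>The expansion is \<phi>2(0) t^2 / 2 + \<phi>3 t^3 / 6 + o(t^3). Since \<phi>2 is assumed
  differentiable only at 0, the cubic term starts from its difference quotient and is carried to
  \<phi>1 and then to \<phi> by l'Hopital's rule.\<close>

lemma DERIV_double_zero_quotient:
  fixes \<phi> \<phi>1 \<phi>2 :: "real \<Rightarrow> real"
  assumes d0: "\<And>t. (\<phi> has_real_derivative \<phi>1 t) (at t)"
    and d1: "\<And>t. (\<phi>1 has_real_derivative \<phi>2 t) (at t)"
    and d2: "(\<phi>2 has_real_derivative \<phi>3) (at 0)"
    and z: "\<phi> 0 = 0" "\<phi>1 0 = 0"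
  shows "((\<lambda>t. if t = 0 then \<phi>2 0 / 2 else \<phi> t / t\<^sup>2) has_real_derivative \<phi>3 / 6) (at 0)"
proof -
  have c0: "isCont \<phi> 0" and c1: "isCont \<phi>1 0" using d0 d1 DERIV_isCont by blast+
  have nz: "\<forall>\<^sub>F h in at (0::real). h \<noteq> 0" by (simp add: eventually_at_filter)
  have "((\<lambda>h. (\<phi>2 h - \<phi>2 0) / h) \<longlongrightarrow> \<phi>3) (at 0)"
    using d2 by (simp add: has_field_derivative_iff)
  from tendsto_divide[OF this tendsto_const[of "6::real"]]
  have l2: "((\<lambda>h. (\<phi>2 h - \<phi>2 0) / (6 * h)) \<longlongrightarrow> \<phi>3 / 6) (at 0)"
    by (simp add: field_simps)
  have l1: "((\<lambda>h. (\<phi>1 h - \<phi>2 0 * h) / (3 * h\<^sup>2)) \<longlongrightarrow> \<phi>3 / 6) (at 0)"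
  proof (rule lhopital[OF _ _ _ _ _ _ l2])
    show "((\<lambda>h. \<phi>1 h - \<phi>2 0 * h) \<longlongrightarrow> 0) (at 0)"
      by (rule tendsto_eq_intros refl isContD[OF c1])+ (simp add: z)
    show "((\<lambda>h::real. 3 * h\<^sup>2) \<longlongrightarrow> 0) (at 0)"
      by (rule tendsto_eq_intros refl)+ simp
    show "\<forall>\<^sub>F h in at 0. ((\<lambda>h. \<phi>1 h - \<phi>2 0 * h) has_real_derivative (\<phi>2 h - \<phi>2 0)) (at h)"
      by (rule always_eventually) (auto intro!: derivative_eq_intros d1)
    show "\<forall>\<^sub>F h in at 0. ((\<lambda>h. 3 * h\<^sup>2) has_real_derivative (6 * h)) (at h)"
      by (rule always_eventually) (auto intro!: derivative_eq_intros)
  qed (use nz in \<open>auto elim: eventually_mono\<close>)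
  have l0: "((\<lambda>h. (\<phi> h - \<phi>2 0 / 2 * h\<^sup>2) / h ^ 3) \<longlongrightarrow> \<phi>3 / 6) (at 0)"
  proof (rule lhopital[OF _ _ _ _ _ _ l1])
    show "((\<lambda>h. \<phi> h - \<phi>2 0 / 2 * h\<^sup>2) \<longlongrightarrow> 0) (at 0)"
      by (rule tendsto_eq_intros refl isContD[OF c0])+ (simp add: z)
    show "((\<lambda>h::real. h ^ 3) \<longlongrightarrow> 0) (at 0)"
      by (rule tendsto_eq_intros refl)+ simp
    show "\<forall>\<^sub>F h in at 0. ((\<lambda>h. \<phi> h - \<phi>2 0 / 2 * h\<^sup>2) has_real_derivative (\<phi>1 h - \<phi>2 0 * h)) (at h)"
      by (rule always_eventually) (auto intro!: derivative_eq_intros d0)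
    show "\<forall>\<^sub>F h in at 0. ((\<lambda>h. h ^ 3) has_real_derivative (3 * h\<^sup>2)) (at h)"
      by (rule always_eventually) (auto intro!: derivative_eq_intros)
  qed (use nz in \<open>auto elim: eventually_mono\<close>)
  have "((\<lambda>h. ((if h = 0 then \<phi>2 0 / 2 else \<phi> h / h\<^sup>2) - \<phi>2 0 / 2) / h) \<longlongrightarrow> \<phi>3 / 6) (at 0)"
    by (rule Lim_transform_eventually[OF l0])
       (use nz in \<open>auto elim!: eventually_mono simp: field_simps power2_eq_square power3_eq_cube\<close>)
  thus ?thesis by (simp add: has_field_derivative_iff)
qed

lemma DERIV_even_0:
  fixes \<Psi> :: "real \<Rightarrow> real"
  assumes "(\<Psi> has_real_derivative D) (at 0)" "\<forall>\<^sub>F t in nhds 0. \<Psi> (- t) = \<Psi> t"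
  shows "D = 0"
proof -
  have "((\<lambda>t. \<Psi> (- t)) has_real_derivative - D) (at 0)"
    using DERIV_mirror[of \<Psi> D 0] assms(1) by simp
  hence "(\<Psi> has_real_derivative - D) (at 0)"
    by (rule DERIV_cong_ev[THEN iffD1, OF refl assms(2) refl])
  from DERIV_unique[OF this assms(1)] show ?thesis by simp
qed

lemma DERIV_zero_on_interval:
  fixes h :: "real \<Rightarrow> real"
  assumes "(h has_real_derivative D) (at s)" "s \<in> {a<..<b}" "\<And>s. s \<in> {a<..<b} \<Longrightarrow> h s = 0"
  shows "D = 0"
proof -
  have "\<forall>\<^sub>F t in nhds s. h t = (\<lambda>_. 0) t"
    using eventually_nhds_in_open[of "{a<..<b}" s] assms(2,3) by (auto elim: eventually_mono)
  from DERIV_cong_ev[THEN iffD1, OF refl this refl assms(1)]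
  show ?thesis using DERIV_const DERIV_unique by blast
qed

text \<open>The circle centred at (x0 - r d, y0 + r c); (c, d) is the unit tangent at (x0, y0) and t
  the counterclockwise angle from that point.\<close>

definition circle_x where "circle_x r x0 c d t = x0 + r * (sin t * c - (1 - cos t) * d)"
definition circle_y where "circle_y r y0 c d t = y0 + r * (sin t * d + (1 - cos t) * c)"

text \<open>Coordinates \<open>x, y\<close> of a curve, of its unit tangent \<open>c, d\<close>, and its signed curvature.\<close>

locale unit_speed_arc =
  fixes x y c d k k' :: "real \<Rightarrow> real" and a b :: real
  assumes ab: "a < b"
    and x': "\<And>s. s \<in> {a<..<b} \<Longrightarrow> (x has_real_derivative c s) (at s)"
    and y': "\<And>s. s \<in> {a<..<b} \<Longrightarrow> (y has_real_derivative d s) (at s)"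
    and c': "\<And>s. s \<in> {a<..<b} \<Longrightarrow> (c has_real_derivative - (k s * d s)) (at s)"
    and d': "\<And>s. s \<in> {a<..<b} \<Longrightarrow> (d has_real_derivative k s * c s) (at s)"
    and cd: "\<And>s. s \<in> {a<..<b} \<Longrightarrow> (c s)\<^sup>2 + (d s)\<^sup>2 = 1"
    and k': "\<And>s. s \<in> {a<..<b} \<Longrightarrow> (k has_real_derivative k' s) (at s)"
begin

text \<open>The derivative of f in the direction (-d, c), the tangent turned by +90 degrees.\<close>

definition normal_deriv :: "real poly poly \<Rightarrow> real \<Rightarrow> real" where
  "normal_deriv f s = eval2 (pderiv f) (x s) (y s) * c s - eval2 (pdx f) (x s) (y s) * d s"

text \<open>The Hessian of f applied to the tangent and this normal.\<close>

definition mixed_hess :: "real poly poly \<Rightarrow> real \<Rightarrow> real" where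
  "mixed_hess f s = (eval2 (pdx (pderiv f)) (x s) (y s) * c s + eval2 (pderiv (pderiv f)) (x s) (y s) * d s) * c s
     - (eval2 (pdx (pdx f)) (x s) (y s) * c s + eval2 (pdx (pderiv f)) (x s) (y s) * d s) * d s"

text \<open>The identity f = 0 is differentiated three times along the arc; the arguments after the
  tangent are the Frenet forms k J\<tau> and k' J\<tau> - k^2 \<tau> of the next two
  derivatives.\<close>

lemma vanishing_jets:
  assumes f: "vanishes_on f x y a b" and s: "s \<in> {a<..<b}"
  shows "eval2 f (x s) (y s) = 0"
    and "jet1 f (x s) (y s) (c s) (d s) = 0"
    and "jet2 f (x s) (y s) (c s) (d s) (- (k s * d s)) (k s * c s) = 0"
    and "jet3 f (x s) (y s) (c s) (d s) (- (k s * d s)) (k s * c s)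
      (- (k' s * d s) - (k s)\<^sup>2 * c s) (k' s * c s - (k s)\<^sup>2 * d s) = 0"
proof -
  have 0: "eval2 f (x s) (y s) = 0" if "s \<in> {a<..<b}" for s
    using f that by (auto simp: vanishes_on_def)
  have 1: "jet1 f (x s) (y s) (c s) (d s) = 0" if s: "s \<in> {a<..<b}" for s
    by (rule DERIV_zero_on_interval[OF DERIV_jet0[OF x'[OF s] y'[OF s]] s 0])
  have 2: "jet2 f (x s) (y s) (c s) (d s) (- (k s * d s)) (k s * c s) = 0" if s: "s \<in> {a<..<b}" for s
    by (rule DERIV_zero_on_interval[OF DERIV_jet1[OF x'[OF s] y'[OF s] c'[OF s] d'[OF s]] s 1])
  have k2: "((\<lambda>s. - (k s * d s)) has_real_derivative - (k' s * d s) - (k s)\<^sup>2 * c s) (at s)"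
           "((\<lambda>s. k s * c s) has_real_derivative k' s * c s - (k s)\<^sup>2 * d s) (at s)"
    using s by (auto intro!: derivative_eq_intros k' c' d' simp: algebra_simps power2_eq_square)
  show "jet3 f (x s) (y s) (c s) (d s) (- (k s * d s)) (k s * c s)
      (- (k' s * d s) - (k s)\<^sup>2 * c s) (k' s * c s - (k s)\<^sup>2 * d s) = 0"
    by (rule DERIV_zero_on_interval[OF DERIV_jet2[OF x'[OF s] y'[OF s] c'[OF s] d'[OF s] k2] s 2])
  show "eval2 f (x s) (y s) = 0" "jet1 f (x s) (y s) (c s) (d s) = 0"
    "jet2 f (x s) (y s) (c s) (d s) (- (k s * d s)) (k s * c s) = 0"
    using 0 1 2 s by auto
qed

text \<open>The rotation of the normal contributes -k times the tangential derivative of f, which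
  vanishes on the arc.\<close>

lemma DERIV_normal_deriv:
  assumes f: "vanishes_on f x y a b" and s: "s \<in> {a<..<b}"
  shows "(normal_deriv f has_real_derivative mixed_hess f s) (at s)"
proof -
  have 1: "eval2 (pdx f) (x s) (y s) * c s + eval2 (pderiv f) (x s) (y s) * d s = 0"
    using vanishing_jets(2)[OF f s] by (simp add: jet1_def)
  have "(normal_deriv f has_real_derivative
      (mixed_hess f s - k s * (eval2 (pdx f) (x s) (y s) * c s + eval2 (pderiv f) (x s) (y s) * d s))) (at s)"
    unfolding normal_deriv_def[abs_def] mixed_hess_def
    by (rule derivative_eq_intros DERIV_eval2 x' y' c' d' s refl)+
       (simp add: algebra_simps power2_eq_square pdx_pderiv)
  thus ?thesis by (simp add: 1)
qed

text \<open>Circle and curve share position and tangent, so the jets of f on the circle are r^2 or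
  r^3 times the vanishing jets on the curve plus corrections from the different acceleration. With 1
  / r = \<beta> the corrections reduce to terms in \<beta> - k and k'.\<close>

lemma circle_jets:
  assumes f: "vanishes_on f x y a b" and s: "s \<in> {a<..<b}" and r: "r * \<beta> = 1"
  shows "jet2 f (x s) (y s) (r * c s) (r * d s) (- (r * d s)) (r * c s) = r\<^sup>2 * (\<beta> - k s) * normal_deriv f s"
    and "jet3 f (x s) (y s) (r * c s) (r * d s) (- (r * d s)) (r * c s) (- (r * c s)) (- (r * d s))
       = r ^ 3 * (3 * (\<beta> - k s) * mixed_hess f s - k' s * normal_deriv f s)"
proof -
  show "jet2 f (x s) (y s) (r * c s) (r * d s) (- (r * d s)) (r * c s) = r\<^sup>2 * (\<beta> - k s) * normal_deriv f s"
  proof -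
    have 1: "jet2 f (x s) (y s) (r * c s) (r * d s) (- (r * d s)) (r * c s)
        = r\<^sup>2 * jet2 f (x s) (y s) (c s) (d s) (- (k s * d s)) (k s * c s) + (r - r\<^sup>2 * k s) * normal_deriv f s"
      unfolding jet1_def jet2_def normal_deriv_def by (simp add: algebra_simps power2_eq_square)
    have "r = r\<^sup>2 * \<beta>" using r by (simp add: power2_eq_square mult.assoc)
    hence "(r - r\<^sup>2 * k s) = r\<^sup>2 * (\<beta> - k s)" by (simp add: algebra_simps)
    thus ?thesis unfolding 1 using vanishing_jets(3)[OF f s] by simp
  qed
  show "jet3 f (x s) (y s) (r * c s) (r * d s) (- (r * d s)) (r * c s) (- (r * c s)) (- (r * d s))
       = r ^ 3 * (3 * (\<beta> - k s) * mixed_hess f s - k' s * normal_deriv f s)"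
  proof -
    have 1: "jet3 f (x s) (y s) (r * c s) (r * d s) (- (r * d s)) (r * c s) (- (r * c s)) (- (r * d s))
        = r ^ 3 * jet3 f (x s) (y s) (c s) (d s) (- (k s * d s)) (k s * c s)
            (- (k' s * d s) - (k s)\<^sup>2 * c s) (k' s * c s - (k s)\<^sup>2 * d s)
          + 3 * (r\<^sup>2 - r ^ 3 * k s) * mixed_hess f s - r ^ 3 * k' s * normal_deriv f s
          + (r ^ 3 * (k s)\<^sup>2 - r) * jet1 f (x s) (y s) (c s) (d s)"
      unfolding jet1_def jet3_def normal_deriv_def mixed_hess_def
      by (simp add: algebra_simps power2_eq_square power3_eq_cube)
    have "r\<^sup>2 = r ^ 3 * \<beta>" using r by (simp add: power2_eq_square power3_eq_cube mult.assoc)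
    thus ?thesis unfolding 1 using vanishing_jets(2,4)[OF f s] by (simp add: algebra_simps)
  qed
qed

end

text \<open>The range 0 < t < pi is that of the arcs along which the billiard map moves a point to
  the tangency and on.\<close>

definition even_on_circle :: "real poly poly \<Rightarrow> real \<Rightarrow> real \<Rightarrow> real \<Rightarrow> real \<Rightarrow> real \<Rightarrow> bool" where
  "even_on_circle h r x0 y0 c d \<longleftrightarrow> (\<forall>t\<in>{0<..<pi}.
     eval2 h (circle_x r x0 c d t) (circle_y r y0 c d t)
     = eval2 h (circle_x r x0 c d (- t)) (circle_y r y0 c d (- t)))"

lemma even_on_circle_near_0:
  assumes "even_on_circle h r x0 y0 c d"
  shows "\<forall>\<^sub>F t in nhds 0. eval2 h (circle_x r x0 c d (- t)) (circle_y r y0 c d (- t))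
     = eval2 h (circle_x r x0 c d t) (circle_y r y0 c d t)"
proof -
  have "eval2 h (circle_x r x0 c d (- t)) (circle_y r y0 c d (- t))
     = eval2 h (circle_x r x0 c d t) (circle_y r y0 c d t)" if "t \<in> {- pi<..<pi}" for t
  proof -
    consider "t = 0" | "t \<in> {0<..<pi}" | "- t \<in> {0<..<pi}" using \<open>t \<in> {- pi<..<pi}\<close> by force
    thus ?thesis using assms unfolding even_on_circle_def by cases force+
  qed
  thus ?thesis using eventually_nhds_in_open[of "{- pi<..<pi}" "0::real"] by (auto elim: eventually_mono)
qed

lemma DERIV_circle:
  "(circle_x r x0 c d has_real_derivative r * (cos t * c - sin t * d)) (at t)"
  "(circle_y r y0 c d has_real_derivative r * (cos t * d + sin t * c)) (at t)"
  "((\<lambda>t. r * (cos t * c - sin t * d)) has_real_derivative r * (- sin t * c - cos t * d)) (at t)"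
  "((\<lambda>t. r * (cos t * d + sin t * c)) has_real_derivative r * (- sin t * d + cos t * c)) (at t)"
  "((\<lambda>t. r * (- sin t * c - cos t * d)) has_real_derivative r * (- cos t * c + sin t * d)) (at t)"
  "((\<lambda>t. r * (- sin t * d + cos t * c)) has_real_derivative r * (- cos t * d - sin t * c)) (at t)"
  unfolding circle_x_def[abs_def] circle_y_def[abs_def]
  by (auto intro!: derivative_eq_intros simp: algebra_simps)

lemma circle_0 [simp]: "circle_x r x0 c d 0 = x0" "circle_y r y0 c d 0 = y0"
  by (simp_all add: circle_x_def circle_y_def)

context unit_speed_arc
begin

text \<open>
  At the tangency point \<open>f\<close> has a double zero on the circle, so \<open>(f / t\<^sup>2)\<^sup>p g\<close> is even and
  differentiable there; the vanishing of its derivative is the conservation law.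
\<close>

lemma conserved_quantity:
  assumes f: "vanishes_on f x y a b" and s: "s \<in> {a<..<b}" and r: "r * \<beta> = 1"
    and even: "even_on_circle (f ^ Suc n * g) r (x s) (y s) (c s) (d s)"
  shows "((\<lambda>s. ((\<beta> - k s) * normal_deriv f s ^ 3) ^ Suc n * eval2 g (x s) (y s) ^ 3) has_real_derivative 0) (at s)"
proof -
  define X where "X = circle_x r (x s) (c s) (d s)"
  define Y where "Y = circle_y r (y s) (c s) (d s)"
  define X1 where "X1 = (\<lambda>t. r * (cos t * c s - sin t * d s))"
  define Y1 where "Y1 = (\<lambda>t. r * (cos t * d s + sin t * c s))"
  define X2 where "X2 = (\<lambda>t. r * (- sin t * c s - cos t * d s))"
  define Y2 where "Y2 = (\<lambda>t. r * (- sin t * d s + cos t * c s))"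
  define w where "w = normal_deriv f s"
  define \<phi> where "\<phi> t = eval2 f (X t) (Y t)" for t
  define \<psi> where "\<psi> t = eval2 g (X t) (Y t)" for t
  define \<phi>1 where "\<phi>1 t = jet1 f (X t) (Y t) (X1 t) (Y1 t)" for t
  define \<phi>2 where "\<phi>2 t = jet2 f (X t) (Y t) (X1 t) (Y1 t) (X2 t) (Y2 t)" for t
  define \<phi>3 where "\<phi>3 = r ^ 3 * (3 * (\<beta> - k s) * mixed_hess f s - k' s * w)"
  define g1 where "g1 = jet1 g (x s) (y s) (c s) (d s)"
  define A where "A t = (if t = 0 then \<phi>2 0 / 2 else \<phi> t / t\<^sup>2)" for t
  have X: "(X has_real_derivative X1 t) (at t)" "(Y has_real_derivative Y1 t) (at t)"
    "(X1 has_real_derivative X2 t) (at t)" "(Y1 has_real_derivative Y2 t) (at t)"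
    "(X2 has_real_derivative r * (- cos t * c s + sin t * d s)) (at t)"
    "(Y2 has_real_derivative r * (- cos t * d s - sin t * c s)) (at t)" for t
    unfolding X_def Y_def X1_def Y1_def X2_def Y2_def by (rule DERIV_circle)+
  have at0: "X 0 = x s" "Y 0 = y s" "X1 0 = r * c s" "Y1 0 = r * d s" "X2 0 = - (r * d s)" "Y2 0 = r * c s"
    by (simp_all add: X_def Y_def X1_def Y1_def X2_def Y2_def)
  have \<phi>20: "\<phi>2 0 = r\<^sup>2 * (\<beta> - k s) * w"
    using circle_jets(1)[OF f s r] by (simp add: \<phi>2_def at0 w_def)
  have A': "(A has_real_derivative \<phi>3 / 6) (at 0)"
    unfolding A_def[abs_def]
  proof (rule DERIV_double_zero_quotient)
    show "(\<phi> has_real_derivative \<phi>1 t) (at t)" for t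
      unfolding \<phi>_def[abs_def] \<phi>1_def by (intro DERIV_jet0 X)
    show "(\<phi>1 has_real_derivative \<phi>2 t) (at t)" for t
      unfolding \<phi>2_def[abs_def] \<phi>1_def[abs_def] by (intro DERIV_jet1 X)
    show "(\<phi>2 has_real_derivative \<phi>3) (at 0)"
      using DERIV_jet2[OF X[of 0], of f] circle_jets(2)[OF f s r]
      by (simp add: \<phi>2_def[abs_def] \<phi>3_def w_def at0)
    show "\<phi> 0 = 0" using vanishing_jets(1)[OF f s] by (simp add: \<phi>_def at0)
    show "\<phi>1 0 = 0" using vanishing_jets(2)[OF f s] by (simp add: \<phi>1_def jet1_def at0 flip: mult.left_commute[of r] distrib_left)
  qed
  have \<psi>': "(\<psi> has_real_derivative r * g1) (at 0)"
    using DERIV_jet0[OF X(1,2)[of 0], of g] by (simp add: \<psi>_def[abs_def] at0 g1_def jet1_def algebra_simps)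
  have "((\<lambda>t. A t ^ Suc n * \<psi> t) has_real_derivative
      (real (Suc n) * A 0 ^ n * (\<phi>3 / 6)) * \<psi> 0 + A 0 ^ Suc n * (r * g1)) (at 0)"
    by (rule derivative_eq_intros A' \<psi>' refl)+ (simp add: algebra_simps)
  moreover have "\<forall>\<^sub>F t in nhds 0. A (- t) ^ Suc n * \<psi> (- t) = A t ^ Suc n * \<psi> t"
    using even_on_circle_near_0[OF even]
    by eventually_elim (auto simp: A_def \<phi>_def \<psi>_def X_def Y_def power_divide)
  ultimately have key: "(real (Suc n) * A 0 ^ n * (\<phi>3 / 6)) * \<psi> 0 + A 0 ^ Suc n * (r * g1) = 0"
    by (rule DERIV_even_0)
  \<comment> \<open>m is the base (\<beta> - k) w^3 of the conserved quantity at s and m1 its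
    derivative along the arc, the derivative of w being \<open>mixed_hess\<close>.\<close>
  define m where "m = (\<beta> - k s) * w ^ 3"
  define m1 where "m1 = - k' s * w ^ 3 + (\<beta> - k s) * (3 * w\<^sup>2 * mixed_hess f s)"
  have g': "((\<lambda>s. eval2 g (x s) (y s)) has_real_derivative g1) (at s)"
    using DERIV_jet0[OF x'[OF s] y'[OF s], of g] by (simp add: g1_def)
  have m': "((\<lambda>s. (\<beta> - k s) * normal_deriv f s ^ 3) has_real_derivative m1) (at s)"
    by (rule derivative_eq_intros DERIV_normal_deriv[OF f s] k'[OF s] refl)+
       (simp add: m1_def w_def algebra_simps power2_eq_square power3_eq_cube)
  have \<psi>0: "\<psi> 0 = eval2 g (x s) (y s)" by (simp add: \<psi>_def at0)
  have deriv: "((\<lambda>s. ((\<beta> - k s) * normal_deriv f s ^ 3) ^ Suc n * eval2 g (x s) (y s) ^ 3) has_real_derivative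
      (real (Suc n) * m ^ n * m1) * \<psi> 0 ^ 3 + m ^ Suc n * (3 * \<psi> 0 ^ 2 * g1)) (at s)"
    unfolding \<psi>0
    by (rule derivative_eq_intros m' g' refl)+
       (simp add: m_def w_def algebra_simps power2_eq_square power3_eq_cube)
  \<comment> \<open>The dictionary between arc and circle: up to powers of r, m and m1 are w^2 times
    the Taylor data on the circle. Carrying the factor w^2 avoids division by w or \<beta> - k,
    which may vanish at s.\<close>
  have r2: "r\<^sup>2 * m = 2 * w\<^sup>2 * A 0"
    by (simp add: m_def A_def \<phi>20 power2_eq_square power3_eq_cube)
  have r3: "r ^ 3 * m1 = w\<^sup>2 * \<phi>3"
    by (simp add: m1_def \<phi>3_def algebra_simps power2_eq_square power3_eq_cube)
  have "r ^ 3 * (r\<^sup>2) ^ n * ((real (Suc n) * m ^ n * m1) * \<psi> 0 ^ 3 + m ^ Suc n * (3 * \<psi> 0 ^ 2 * g1))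
     = real (Suc n) * (r\<^sup>2 * m) ^ n * (r ^ 3 * m1) * \<psi> 0 ^ 3 + 3 * r * (r\<^sup>2 * m) ^ Suc n * \<psi> 0 ^ 2 * g1"
    by (simp add: power_mult_distrib algebra_simps power2_eq_square power3_eq_cube)
  also have "\<dots> = 6 * (2 * w\<^sup>2) ^ n * w\<^sup>2 * \<psi> 0 ^ 2 *
       ((real (Suc n) * A 0 ^ n * (\<phi>3 / 6)) * \<psi> 0 + A 0 ^ Suc n * (r * g1))"
    unfolding r2 r3 by (simp add: power_mult_distrib algebra_simps power2_eq_square power3_eq_cube)
  also have "\<dots> = 0" unfolding key by simp
  finally have "(real (Suc n) * m ^ n * m1) * \<psi> 0 ^ 3 + m ^ Suc n * (3 * \<psi> 0 ^ 2 * g1) = 0"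
    using r by auto
  with deriv show ?thesis by simp
qed

text \<open>The derivative of an even function vanishes at t = 0, and on the Larmor circle it equals
  r times the derivative of h along the curve.\<close>

lemma even_on_circle_imp_deriv_0:
  assumes "even_on_circle h r (x s) (y s) (c s) (d s)" "r \<noteq> 0" "s \<in> {a<..<b}"
  shows "((\<lambda>s. eval2 h (x s) (y s)) has_real_derivative 0) (at s)"
proof -
  have "jet1 h (x s) (y s) (r * c s) (r * d s) = 0"
  proof (rule DERIV_even_0[OF _ even_on_circle_near_0[OF assms(1)]])
    show "((\<lambda>t. eval2 h (circle_x r (x s) (c s) (d s) t) (circle_y r (y s) (c s) (d s) t)) has_real_derivative
      jet1 h (x s) (y s) (r * c s) (r * d s)) (at 0)"
      by (rule DERIV_cong, rule DERIV_jet0, rule DERIV_circle(1), rule DERIV_circle(2)) simp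
  qed
  hence "jet1 h (x s) (y s) (c s) (d s) = 0" using assms(2) by (simp add: jet1_def flip: mult.left_commute[of r] distrib_left)
  thus ?thesis using DERIV_jet0[OF x'[OF assms(3)] y'[OF assms(3)], of h] by simp
qed

lemma const_on_arc:
  assumes "\<And>s. s \<in> {a<..<b} \<Longrightarrow> (h has_real_derivative 0) (at s)"
  obtains C where "\<And>s. s \<in> {a<..<b} \<Longrightarrow> h s = (C :: real)"
  using has_field_derivative_zero_constant[of "{a<..<b}" h] assms
  by (metis convex_real_interval(8) has_field_derivative_at_within)

text \<open>Since the tangential derivative of f vanishes, its gradient is w times (-d, c), that is
  w c = f_y and w d = - f_x. Multiplying the second-order relation by w^2 then eliminates c and d
  and leaves the numerator of the classical curvature formula for an implicit curve.\<close>

lemma normal_deriv_algebraic: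
  assumes f: "vanishes_on f x y a b" and s: "s \<in> {a<..<b}"
  shows "normal_deriv f s * c s = eval2 (pderiv f) (x s) (y s)"
    and "(normal_deriv f s)\<^sup>2 = eval2 ((pdx f)\<^sup>2 + (pderiv f)\<^sup>2) (x s) (y s)"
    and "k s * normal_deriv f s ^ 3 = - eval2 (pdx (pdx f) * (pderiv f)\<^sup>2
          - [:2:] * pdx (pderiv f) * pdx f * pderiv f + pderiv (pderiv f) * (pdx f)\<^sup>2) (x s) (y s)"
proof -
  define u v where "u = eval2 (pdx f) (x s) (y s)" and "v = eval2 (pderiv f) (x s) (y s)"
  define w where "w = normal_deriv f s"
  define C D where "C = c s" and "D = d s"
  have 1: "u * C + v * D = 0" using vanishing_jets(2)[OF f s] by (simp add: jet1_def u_def v_def C_def D_def)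
  have 2: "C\<^sup>2 + D\<^sup>2 = 1" using cd[OF s] by (simp add: C_def D_def)
  have w: "w = v * C - u * D" by (simp add: w_def normal_deriv_def u_def v_def C_def D_def)
  have uC: "u * C = - (v * D)" and vD: "v * D = - (u * C)" using 1 by simp_all
  have "w * C = v * C\<^sup>2 - (u * C) * D" by (simp add: w algebra_simps power2_eq_square)
  also have "\<dots> = v * (C\<^sup>2 + D\<^sup>2)" unfolding uC by (simp add: algebra_simps power2_eq_square)
  finally have wc: "w * C = v" by (simp add: 2)
  have "w * D = (v * D) * C - u * D\<^sup>2" by (simp add: w algebra_simps power2_eq_square)
  also have "\<dots> = - u * (C\<^sup>2 + D\<^sup>2)" unfolding vD by (simp add: algebra_simps power2_eq_square)
  finally have wd: "w * D = - u" by (simp add: 2)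
  show "normal_deriv f s * c s = eval2 (pderiv f) (x s) (y s)" using wc by (simp add: w_def v_def C_def)
  have "w\<^sup>2 = w\<^sup>2 * (C\<^sup>2 + D\<^sup>2)" by (simp add: 2)
  also have "\<dots> = (w * C)\<^sup>2 + (w * D)\<^sup>2" by (simp add: algebra_simps)
  also have "\<dots> = u\<^sup>2 + v\<^sup>2" by (simp add: wc wd)
  finally have "w\<^sup>2 = u\<^sup>2 + v\<^sup>2" .
  thus "(normal_deriv f s)\<^sup>2 = eval2 ((pdx f)\<^sup>2 + (pderiv f)\<^sup>2) (x s) (y s)" by (simp add: w_def u_def v_def)
  define p q t where "p = eval2 (pdx (pdx f)) (x s) (y s)" and "q = eval2 (pdx (pderiv f)) (x s) (y s)"
    and "t = eval2 (pderiv (pderiv f)) (x s) (y s)"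
  define K where "K = k s"
  have "p * C\<^sup>2 + 2 * q * C * D + t * D\<^sup>2 + K * w = 0"
    using vanishing_jets(3)[OF f s]
    by (simp add: jet2_def jet1_def w u_def v_def p_def q_def t_def C_def D_def K_def algebra_simps)
  hence "K * w = - (p * C\<^sup>2 + 2 * q * C * D + t * D\<^sup>2)" by simp
  hence "w\<^sup>2 * (K * w) = w\<^sup>2 * (- (p * C\<^sup>2 + 2 * q * C * D + t * D\<^sup>2))" by simp
  hence "K * w ^ 3 = - (p * (w * C)\<^sup>2 + 2 * q * (w * C) * (w * D) + t * (w * D)\<^sup>2)"
    by (simp add: algebra_simps power2_eq_square power3_eq_cube)
  also have "\<dots> = - (p * v\<^sup>2 - 2 * q * u * v + t * u\<^sup>2)" unfolding wc wd by simp
  finally show "k s * normal_deriv f s ^ 3 = - eval2 (pdx (pdx f) * (pderiv f)\<^sup>2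
          - [:2:] * pdx (pderiv f) * pdx f * pderiv f + pderiv (pderiv f) * (pdx f)\<^sup>2) (x s) (y s)"
    by (simp add: w_def u_def v_def p_def q_def t_def K_def eval2_degree_0)
qed

end

subsection \<open>Finiteness on an arc\<close>

lemma inj_on_of_deriv_nonzero:
  fixes h :: "real \<Rightarrow> real"
  assumes "\<And>s. s \<in> {a<..<b} \<Longrightarrow> (h has_real_derivative h' s) (at s)"
    and "\<And>s. s \<in> {a<..<b} \<Longrightarrow> h' s \<noteq> 0"
  shows "inj_on h {a<..<b}"
proof -
  have "False" if "s \<in> {a<..<b}" "t \<in> {a<..<b}" "h s = h t" "s < t" for s t
  proof -
    have "(h has_real_derivative h' z) (at z)" if "s \<le> z" "z \<le> t" for z
      using assms(1) that \<open>s \<in> {a<..<b}\<close> \<open>t \<in> {a<..<b}\<close> by auto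
    from MVT2[OF \<open>s < t\<close> this] obtain z where "s < z" "z < t" "h t - h s = (t - s) * h' z" by blast
    moreover have "h' z \<noteq> 0" using assms(2)[of z] calculation that by auto
    ultimately show False using that by auto
  qed
  thus ?thesis by (metis inj_onI linorder_neqE_linordered_idom)
qed

context unit_speed_arc
begin

lemma subarc: "a \<le> a' \<Longrightarrow> a' < b' \<Longrightarrow> b' \<le> b \<Longrightarrow> unit_speed_arc x y c d k k' a' b'"
  by unfold_locales (auto intro: x' y' c' d' cd k')

text \<open>In the application w^2 is a polynomial on the arc, so these functions form a ring; both
  w and (\<beta> - k) w^3 belong to it.\<close>

definition arc_rep :: "(real \<Rightarrow> real) \<Rightarrow> (real \<Rightarrow> real) \<Rightarrow> bool" where
  "arc_rep w h \<longleftrightarrow> (\<exists>A B. \<forall>s\<in>{a<..<b}. h s = eval2 A (x s) (y s) + eval2 B (x s) (y s) * w s)"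

lemma arc_rep_poly: "arc_rep w (\<lambda>s. eval2 A (x s) (y s))"
  unfolding arc_rep_def by (rule exI[of _ A], rule exI[of _ 0]) simp

lemma arc_rep_w: "arc_rep w w"
  unfolding arc_rep_def by (rule exI[of _ 0], rule exI[of _ 1]) simp

lemma arc_rep_cong: "arc_rep w h \<Longrightarrow> (\<And>s. s \<in> {a<..<b} \<Longrightarrow> h s = h' s) \<Longrightarrow> arc_rep w h'"
  unfolding arc_rep_def by metis

lemma arc_rep_add:
  assumes "arc_rep w h" "arc_rep w h'"
  shows "arc_rep w (\<lambda>s. h s + h' s)"
proof -
  obtain A B A' B' where *: "\<And>s. s \<in> {a<..<b} \<Longrightarrow> h s = eval2 A (x s) (y s) + eval2 B (x s) (y s) * w s"
    "\<And>s. s \<in> {a<..<b} \<Longrightarrow> h' s = eval2 A' (x s) (y s) + eval2 B' (x s) (y s) * w s"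
    using assms unfolding arc_rep_def by metis
  show ?thesis unfolding arc_rep_def
    by (rule exI[of _ "A + A'"], rule exI[of _ "B + B'"]) (simp add: * algebra_simps)
qed

lemma arc_rep_mult:
  assumes "arc_rep w h" "arc_rep w h'" and E: "\<And>s. s \<in> {a<..<b} \<Longrightarrow> (w s)\<^sup>2 = eval2 E (x s) (y s)"
  shows "arc_rep w (\<lambda>s. h s * h' s)"
proof -
  obtain A B A' B' where *: "\<And>s. s \<in> {a<..<b} \<Longrightarrow> h s = eval2 A (x s) (y s) + eval2 B (x s) (y s) * w s"
    "\<And>s. s \<in> {a<..<b} \<Longrightarrow> h' s = eval2 A' (x s) (y s) + eval2 B' (x s) (y s) * w s"
    using assms unfolding arc_rep_def by metis
  show ?thesis unfolding arc_rep_def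
    by (rule exI[of _ "A * A' + E * B * B'"], rule exI[of _ "A * B' + A' * B"])
       (simp add: * E[symmetric] algebra_simps power2_eq_square)
qed

lemma arc_rep_power:
  assumes "arc_rep w h" and E: "\<And>s. s \<in> {a<..<b} \<Longrightarrow> (w s)\<^sup>2 = eval2 E (x s) (y s)"
  shows "arc_rep w (\<lambda>s. h s ^ n)"
proof (induction n)
  case 0
  show ?case using arc_rep_poly[of w 1] by simp
next
  case (Suc n)
  from arc_rep_mult[OF assms(1) Suc E] show ?case by simp
qed

text \<open>Once the conserved constant K is known to be nonzero, w^3 m^n g^3 / K is an inverse of
  \<beta> - k of the form A + B w, and integrality applies to it.\<close>

lemma annihilator_of_curvature:
  assumes f: "vanishes_on f x y a b" "degree f > 0"
    and fdvd: "\<And>h c d. a \<le> c \<Longrightarrow> c < d \<Longrightarrow> d \<le> b \<Longrightarrow> vanishes_on h x y c d \<Longrightarrow> f dvd h"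
    and r: "r * \<beta> = 1"
    and h: "\<And>C. h \<noteq> [:[:C:]:]"
    and even: "\<And>s. s \<in> {a<..<b} \<Longrightarrow> even_on_circle h r (x s) (y s) (c s) (d s)"
    and k_inj: "inj_on k {a<..<b}"
  obtains Q N where "poly Q [:\<beta>:] = lead_coeff f ^ N" "vanishes_on Q x k a b"
proof -
  have r0: "r \<noteq> 0" using r by auto
  obtain C where C: "\<And>s. s \<in> {a<..<b} \<Longrightarrow> eval2 h (x s) (y s) = C"
    using const_on_arc[OF even_on_circle_imp_deriv_0[OF even r0]] by blast
  define h0 where "h0 = h - [:[:C:]:]"
  have h0: "h0 \<noteq> 0" using h[of C] by (auto simp: h0_def)
  have "vanishes_on h0 x y a b" by (simp add: vanishes_on_def h0_def C)
  hence "f dvd h0" using fdvd ab by blast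
  have f0: "f \<noteq> 0" and nu: "\<not> is_unit f" using f(2) by (auto simp: poly_dvd_1)
  define p where "p = multiplicity f h0"
  obtain g where g: "h0 = f ^ p * g" "\<not> f dvd g"
    using multiplicity_decompose'[OF h0 nu] unfolding p_def by blast
  have "p \<noteq> 0" using g \<open>f dvd h0\<close> by (metis mult_1 power_0)
  then obtain n where n: "p = Suc n" using not0_implies_Suc by blast
  have even0: "even_on_circle (f ^ Suc n * g) r (x s) (y s) (c s) (d s)" if "s \<in> {a<..<b}" for s
    using even[OF that] unfolding even_on_circle_def by (simp add: h0_def flip: g(1) n del: power_Suc)
  define w where "w = normal_deriv f"
  define m where "m s = (\<beta> - k s) * w s ^ 3" for s
  define E where "E = (pdx f)\<^sup>2 + (pderiv f)\<^sup>2"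
  define H where "H = pdx (pdx f) * (pderiv f)\<^sup>2
          - [:2:] * pdx (pderiv f) * pdx f * pderiv f + pderiv (pderiv f) * (pdx f)\<^sup>2"
  have wE: "(w s)\<^sup>2 = eval2 E (x s) (y s)" if "s \<in> {a<..<b}" for s
    using normal_deriv_algebraic(2)[OF f(1) that] by (simp add: E_def w_def)
  obtain K where K: "\<And>s. s \<in> {a<..<b} \<Longrightarrow> m s ^ Suc n * eval2 g (x s) (y s) ^ 3 = K"
    using const_on_arc[OF conserved_quantity[OF f(1) _ r even0]] unfolding m_def w_def by blast
  \<comment> \<open>If K = 0, then w g vanishes off the finitely many points with k = \<beta>, and w
    c = f_y gives f_y g = 0 there. Were g nonzero somewhere, f_y would vanish on an interval and f
    would divide its own y-derivative, of smaller degree. So g vanishes on a subinterval and f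
    divides g, against the choice of the multiplicity p.\<close>
  have "K \<noteq> 0"
  proof
    assume "K = 0"
    have "finite {s\<in>{a<..<b}. k s = \<beta>}"
    proof (rule finite_imageD)
      show "finite (k ` {s\<in>{a<..<b}. k s = \<beta>})" by (rule finite_subset[of _ "{\<beta>}"]) auto
      show "inj_on k {s\<in>{a<..<b}. k s = \<beta>}" using k_inj by (rule inj_on_subset) auto
    qed
    from subinterval_avoiding_finite[OF ab this] obtain a' b' where
      ab': "a \<le> a'" "a' < b'" "b' \<le> b" "{a'<..<b'} \<inter> {s\<in>{a<..<b}. k s = \<beta>} = {}" .
    have zero: "eval2 (pderiv f) (x s) (y s) = 0 \<or> eval2 g (x s) (y s) = 0" if "s \<in> {a'<..<b'}" for s
    proof -
      have s: "s \<in> {a<..<b}" and "k s \<noteq> \<beta>" using that ab' by auto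
      hence "w s = 0 \<or> eval2 g (x s) (y s) = 0" using K[OF s] \<open>K = 0\<close> by (auto simp: m_def)
      thus ?thesis using normal_deriv_algebraic(1)[OF f(1) s] by (auto simp: w_def)
    qed
    have "vanishes_on g x y a' b'"
      unfolding vanishes_on_def
    proof (rule ccontr)
      assume "\<not> (\<forall>s\<in>{a'<..<b'}. eval2 g (x s) (y s) = 0)"
      then obtain s where s: "s \<in> {a'<..<b'}" "eval2 g (x s) (y s) \<noteq> 0" by blast
      have s': "s \<in> {a<..<b}" using s ab' by auto
      have "isCont (\<lambda>s. eval2 g (x s) (y s)) s"
        using DERIV_jet0[OF x'[OF s'] y'[OF s']] DERIV_isCont by blast
      hence "\<forall>\<^sub>F t in nhds s. eval2 g (x t) (y t) \<noteq> 0"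
        using s(2) by (simp add: isCont_def tendsto_imp_eventually_ne eventually_nhds_conv_at)
      moreover have "\<forall>\<^sub>F t in nhds s. t \<in> {a'<..<b'}" by (rule eventually_nhds_in_open[OF open_greaterThanLessThan s(1)])
      ultimately have "\<forall>\<^sub>F t in nhds s. t \<in> {a'<..<b'} \<and> eval2 (pderiv f) (x t) (y t) = 0"
        by eventually_elim (use zero in blast)
      then obtain e where e: "e > 0" "\<And>t. dist t s < e \<Longrightarrow> t \<in> {a'<..<b'} \<and> eval2 (pderiv f) (x t) (y t) = 0"
        unfolding eventually_nhds_metric by blast
      have "vanishes_on (pderiv f) x y (max a' (s - e)) (min b' (s + e))"
        using e(2) by (auto simp: vanishes_on_def dist_real_def)
      moreover have "a \<le> max a' (s - e)" "max a' (s - e) < min b' (s + e)" "min b' (s + e) \<le> b"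
        using ab' s(1) e(1) by auto
      ultimately have "f dvd pderiv f" using fdvd by blast
      hence "degree f \<le> degree (pderiv f)"
        by (rule dvd_imp_degree_le) (use f(2) in \<open>auto simp: pderiv_eq_0_iff\<close>)
      thus False using f(2) by (simp add: degree_pderiv)
    qed
    hence "f dvd g" using fdvd ab' by blast
    thus False using g(2) by blast
  qed
  \<comment> \<open>m = \<beta> w^3 - k w^3, where w^3 = E w and - k w^3 = H on the arc.\<close>
  have m_rep: "arc_rep w m"
  proof (rule arc_rep_cong)
    show "arc_rep w (\<lambda>s. eval2 H (x s) (y s) + eval2 ([:[:\<beta>:]:] * E) (x s) (y s) * w s)"
      by (intro arc_rep_add arc_rep_mult[OF _ _ wE] arc_rep_poly arc_rep_w)
    show "eval2 H (x s) (y s) + eval2 ([:[:\<beta>:]:] * E) (x s) (y s) * w s = m s" if "s \<in> {a<..<b}" for s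
      using normal_deriv_algebraic(3)[OF f(1) that] wE[OF that]
      by (simp add: m_def w_def H_def algebra_simps power2_eq_square power3_eq_cube)
  qed
  have "arc_rep w (\<lambda>s. w s ^ 3 * (m s ^ n * (eval2 g (x s) (y s) ^ 3 * eval2 [:[:inverse K:]:] (x s) (y s))))"
    by (intro arc_rep_mult[OF _ _ wE] arc_rep_power[OF _ wE] arc_rep_poly arc_rep_w m_rep)
  then obtain A B where AB: "\<And>s. s \<in> {a<..<b} \<Longrightarrow> w s ^ 3 * (m s ^ n * (eval2 g (x s) (y s) ^ 3 * inverse K))
      = eval2 A (x s) (y s) + eval2 B (x s) (y s) * w s"
    unfolding arc_rep_def by (auto simp: eval2_degree_0)
  have "(\<beta> - k s) * (eval2 A (x s) (y s) + eval2 B (x s) (y s) * w s) = 1" if s: "s \<in> {a<..<b}" for s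
  proof -
    have "(\<beta> - k s) * (w s ^ 3 * (m s ^ n * (eval2 g (x s) (y s) ^ 3 * inverse K)))
       = (m s ^ Suc n * eval2 g (x s) (y s) ^ 3) * inverse K" by (simp add: m_def algebra_simps)
    also have "\<dots> = 1" using K[OF s] \<open>K \<noteq> 0\<close> by simp
    finally show ?thesis unfolding AB[OF s] .
  qed
  moreover have "eval2 f (x s) (y s) = 0" if "s \<in> {a<..<b}" for s using f(1) that by (auto simp: vanishes_on_def)
  ultimately show ?thesis
    using annihilator_of_shifted_inverse[OF f(2), of "{a<..<b}" x y w E \<beta> k A B] wE that
    unfolding vanishes_on_def by metis
qed

text \<open>Nonvanishing of c and k' makes x and k injective; this keeps the exceptional points
  finite and makes finiteness of the values of x or k on an interval contradictory.\<close>

theorem finitely_many_even_fields: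
  assumes inf: "infinite \<B>" "0 \<notin> \<B>"
    and ev: "\<And>\<beta>. \<beta> \<in> \<B> \<Longrightarrow> \<exists>h. (\<forall>C. h \<noteq> [:[:C:]:]) \<and>
      (\<forall>s\<in>{a<..<b}. even_on_circle h (1 / \<beta>) (x s) (y s) (c s) (d s))"
    and c0: "\<And>s. s \<in> {a<..<b} \<Longrightarrow> c s \<noteq> 0"
    and k0: "\<And>s. s \<in> {a<..<b} \<Longrightarrow> k' s \<noteq> 0"
  shows False
proof -
  have x_inj: "inj_on x {a<..<b}" by (rule inj_on_of_deriv_nonzero[OF x' c0])
  have k_inj: "inj_on k {a<..<b}" by (rule inj_on_of_deriv_nonzero[OF k' k0])
  obtain \<beta>0 where \<beta>0: "\<beta>0 \<in> \<B>" using infinite_imp_nonempty[OF inf(1)] by blast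
  have "\<beta>0 \<noteq> 0" using \<beta>0 inf(2) by auto
  obtain h0 where h0: "\<And>C. h0 \<noteq> [:[:C:]:]"
    "\<And>s. s \<in> {a<..<b} \<Longrightarrow> even_on_circle h0 (1 / \<beta>0) (x s) (y s) (c s) (d s)"
    using ev[OF \<beta>0] by blast
  have "1 / \<beta>0 \<noteq> 0" using \<open>\<beta>0 \<noteq> 0\<close> by simp
  obtain C where C: "\<And>s. s \<in> {a<..<b} \<Longrightarrow> eval2 h0 (x s) (y s) = C"
    using const_on_arc[OF even_on_circle_imp_deriv_0[OF h0(2) \<open>1 / \<beta>0 \<noteq> 0\<close>]] by blast
  have "vanishes_on (h0 - [:[:C:]:]) x y a b" by (simp add: vanishes_on_def C)
  moreover have "h0 - [:[:C:]:] \<noteq> 0" using h0(1)[of C] by auto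
  ultimately obtain f a1 b1 where ab1: "a \<le> a1" "a1 < b1" "b1 \<le> b" and f: "content f = 1" "vanishes_on f x y a1 b1"
    and fdvd: "\<And>h c d. a1 \<le> c \<Longrightarrow> c < d \<Longrightarrow> d \<le> b1 \<Longrightarrow> vanishes_on h x y c d \<Longrightarrow> f dvd h"
    using local_minimal_polynomial[OF ab x_inj, of _ y] by metis
  have sub: "s \<in> {a<..<b}" if "s \<in> {a1<..<b1}" for s using that ab1 by auto
  have x_inj1: "inj_on x {a1<..<b1}" and k_inj1: "inj_on k {a1<..<b1}"
    using x_inj k_inj sub by (meson inj_on_subset subsetI)+
  have f0: "f \<noteq> 0" using f(1) by auto
  \<comment> \<open>An f free of y would confine x to the roots of one polynomial.\<close>
  have degf: "degree f > 0"
  proof (rule ccontr)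
    assume "\<not> degree f > 0"
    then obtain p where p: "f = [:p:]" using degree_eq_zeroE by blast
    hence "p \<noteq> 0" using f0 by auto
    have "x ` {a1<..<b1} \<subseteq> {t. poly p t = 0}" using f(2) by (auto simp: vanishes_on_def p)
    hence "finite (x ` {a1<..<b1})" using poly_roots_finite[OF \<open>p \<noteq> 0\<close>] finite_subset by blast
    thus False using finite_imageD[OF _ x_inj1] ab1(2) infinite_Ioo by blast
  qed
  interpret A1: unit_speed_arc x y c d k k' a1 b1 by (rule subarc[OF ab1])
  have ann: "\<exists>Q N. poly Q [:\<beta>:] = lead_coeff f ^ N \<and> vanishes_on Q x k a1 b1" if \<beta>: "\<beta> \<in> \<B>" for \<beta>
  proof -
    obtain h where h: "\<And>C. h \<noteq> [:[:C:]:]"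
      "\<And>s. s \<in> {a<..<b} \<Longrightarrow> even_on_circle h (1 / \<beta>) (x s) (y s) (c s) (d s)"
      using ev[OF \<beta>] by blast
    have "1 / \<beta> * \<beta> = 1" using inf(2) \<beta> by auto
    note r = this
    show ?thesis
    proof (rule A1.annihilator_of_curvature[OF f(2) degf _ r h(1) _ k_inj1])
      show "f dvd g" if "a1 \<le> u" "u < v" "v \<le> b1" "vanishes_on g x y u v" for g u v
        using that by (rule fdvd)
      show "even_on_circle h (1 / \<beta>) (x s) (y s) (c s) (d s)" if "s \<in> {a1<..<b1}" for s
        using h(2)[OF sub[OF that]] .
      show ?thesis if "poly Q [:\<beta>:] = lead_coeff f ^ N" "vanishes_on Q x k a1 b1" for Q N
        using that by blast
    qed
  qed
  \<comment> \<open>One field \<beta>0 already shows that x and k are algebraically dependent on the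
    arc, so that M exists.\<close>
  obtain Q0 N0 where Q0: "poly Q0 [:\<beta>0:] = lead_coeff f ^ N0" "vanishes_on Q0 x k a1 b1"
    using ann[OF \<beta>0] by blast
  have "Q0 \<noteq> 0" using Q0(1) f0 by auto
  from local_minimal_polynomial[OF ab1(2) x_inj1 this Q0(2)]
  obtain M a2 b2 where ab2: "a1 \<le> a2" "a2 < b2" "b2 \<le> b1" and M: "content M = 1" "vanishes_on M x k a2 b2"
    and Mdvd: "\<And>h c d. a2 \<le> c \<Longrightarrow> c < d \<Longrightarrow> d \<le> b2 \<Longrightarrow> vanishes_on h x k c d \<Longrightarrow> M dvd h"
    by metis
  have "\<exists>n. poly M [:\<beta>:] dvd lead_coeff f ^ n" if \<beta>: "\<beta> \<in> \<B>" for \<beta>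
  proof -
    obtain Q N where Q: "poly Q [:\<beta>:] = lead_coeff f ^ N" "vanishes_on Q x k a1 b1"
      using ann[OF \<beta>] by blast
    have "M dvd Q" using Mdvd[OF order_refl ab2(2) order_refl] vanishes_on_subset[OF Q(2) ab2(1,3)] by blast
    then obtain R where "Q = M * R" unfolding dvd_def by blast
    hence "lead_coeff f ^ N = poly M [:\<beta>:] * poly R [:\<beta>:]" using Q(1) by simp
    thus ?thesis by (metis dvd_triv_left)
  qed
  from specializations_dvd_power_imp_const[OF inf(1) M(1) _ this]
  obtain N where N: "M = map_poly (\<lambda>c. [:c:]) N" using f0 by auto
  have "N \<noteq> 0" using M(1) N by auto
  \<comment> \<open>With constant coefficients the relation M(x, k) = 0 reads N(k) = 0.\<close>
  have "k ` {a2<..<b2} \<subseteq> {t. poly N t = 0}"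
    using M(2) by (auto simp: vanishes_on_def N eval2_def poly_map_poly_const)
  hence "finite (k ` {a2<..<b2})" using poly_roots_finite[OF \<open>N \<noteq> 0\<close>] finite_subset by blast
  moreover have "inj_on k {a2<..<b2}" using k_inj1 by (rule inj_on_subset) (use ab2 in auto)
  ultimately show False using finite_imageD ab2(2) infinite_Ioo by blast
qed

end

subsection \<open>Winding numbers and trigonometric inequalities\<close>

lemma has_vector_derivative_inner_right:
  "(f has_vector_derivative D) (at t) \<Longrightarrow> ((\<lambda>t. f t \<bullet> a) has_real_derivative D \<bullet> a) (at t)"
  unfolding has_real_derivative_iff_has_vector_derivative
  by (rule bounded_linear.has_vector_derivative[OF bounded_linear_inner_left])

text \<open>Im (g' * cnj (g - z)) is |g - z|^2 times the angular velocity of g around z. The sign of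
  the winding number is what separates the two orientations and later shows that a point is
  enclosed.\<close>

lemma winding_number_sign_pos:
  fixes g g' :: "real \<Rightarrow> complex"
  assumes g: "\<And>t. (g has_vector_derivative g' t) (at t)" and cont: "continuous_on UNIV g'"
    and pos: "\<And>t. Im (g' t * cnj (g t - z)) > 0"
  shows "z \<notin> path_image g" "0 < Re (winding_number g z)"
proof -
  have contg: "continuous_on UNIV g"
    using g by (meson continuous_at_imp_continuous_on has_vector_derivative_continuous)
  show z: "z \<notin> path_image g"
  proof
    assume "z \<in> path_image g"
    then obtain t where "g t = z" by (auto simp: path_image_def)
    thus False using pos[of t] by simp
  qed
  have "continuous_on {0..1} (\<lambda>t. Im (g' t * cnj (g t - z)))"
    by (intro continuous_intros continuous_on_subset[OF cont] continuous_on_subset[OF contg]) auto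
  \<comment> \<open>Compactness supplies the positive lower bound that the winding number estimate
    requires.\<close>
  hence "\<exists>t0\<in>{0..1}. \<forall>t\<in>{0..1}. Im (g' t0 * cnj (g t0 - z)) \<le> Im (g' t * cnj (g t - z))"
    using continuous_attains_inf[OF compact_Icc, of 0 "1::real"] by simp
  then obtain t0 where t0: "\<And>t. t \<in> {0..1} \<Longrightarrow> Im (g' t0 * cnj (g t0 - z)) \<le> Im (g' t * cnj (g t - z))"
    by blast
  have "g C1_differentiable_on {0..1}"
    unfolding C1_differentiable_on_def using g continuous_on_subset[OF cont] by blast
  hence "valid_path g" unfolding valid_path_def by (rule C1_differentiable_imp_piecewise)
  thus "0 < Re (winding_number g z)"
    by (rule winding_number_pos_lt[OF _ z pos[of t0]])
       (use t0 vector_derivative_at[OF g] in auto)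
qed

lemma winding_number_sign_neg:
  fixes g g' :: "real \<Rightarrow> complex"
  assumes g: "\<And>t. (g has_vector_derivative g' t) (at t)" and cont: "continuous_on UNIV g'"
    and neg: "\<And>t. Im (g' t * cnj (g t - z)) < 0"
  shows "z \<notin> path_image g" "Re (winding_number g z) < 0"
proof -
  have g1: "(reversepath g has_vector_derivative - g' (1 - t)) (at t)" for t
  proof -
    have "((\<lambda>t::real. 1 - t) has_vector_derivative -1) (at t)"
      by (auto intro!: derivative_eq_intros)
    from vector_diff_chain_at[OF this g] show ?thesis by (simp add: o_def reversepath_def)
  qed
  have c1: "continuous_on UNIV (\<lambda>t. - g' (1 - t))"
    by (intro continuous_intros continuous_on_compose2[OF cont]) auto
  have p1: "Im (- g' (1 - t) * cnj (reversepath g t - z)) > 0" for t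
    using neg[of "1 - t"] by (simp add: reversepath_def)
  have "path g" unfolding path_def
    using g by (meson continuous_at_imp_continuous_on has_vector_derivative_continuous)
  show z: "z \<notin> path_image g" using winding_number_sign_pos(1)[OF g1 c1 p1] by simp
  have "0 < Re (winding_number (reversepath g) z)" by (rule winding_number_sign_pos(2)[OF g1 c1 p1])
  thus "Re (winding_number g z) < 0" using winding_number_reversepath[OF \<open>path g\<close> z] by simp
qed

text \<open>The picture is two Larmor circles through one point P, in units of r: \<theta> and
  \<theta>' are the arcs from P to the tangency points, \<delta> is the angle between the normals
  there. Conditions 1 and 2 put each tangency point on the side of the other's tangent line away
  from the normal.\<close>

lemma tangent_circles_exterior:
  fixes \<theta> \<theta>' \<delta> :: real
  assumes "0 < \<theta>" "\<theta> < pi" "0 < \<theta>'" "\<theta>' < pi" "0 < \<delta>" "\<delta> \<le> pi"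
    and 1: "1 - cos \<delta> + cos (\<delta> - \<theta>') \<le> cos \<theta>"
    and 2: "1 - cos \<delta> + cos (\<delta> + \<theta>) \<le> cos \<theta>'"
  shows False
proof -
  \<comment> \<open>Half angles turn both conditions into upper bounds for 0 < (sin h)^2 by products
    of two sines, whose signs can be discussed.\<close>
  define a b h where "a = (\<theta> + \<theta>') / 2" and "b = (\<theta> - \<theta>') / 2" and "h = \<delta> / 2"
  have eqs: "\<theta> = a + b" "\<theta>' = a - b" "\<delta> = 2 * h" by (simp_all add: a_def b_def h_def field_simps)
  have bounds: "0 < h" "h \<le> pi / 2" "\<bar>b\<bar> < a" "a + \<bar>b\<bar> < pi"
    using assms(1-6) unfolding eqs by auto
  have s1: "cos (a + b) - cos (2 * h - (a - b)) = 2 * sin (h + b) * sin (h - a)"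
    by (simp add: cos_diff_cos algebra_simps)
  have s2: "cos (a - b) - cos (2 * h + (a + b)) = 2 * sin (h + a) * sin (h + b)"
    by (simp add: cos_diff_cos algebra_simps)
  have s3: "1 - cos (2 * h) = 2 * (sin h)\<^sup>2" by (simp add: cos_double_sin)
  have sh: "sin h > 0" using bounds by (intro sin_gt_zero) auto
  have A: "(sin h)\<^sup>2 \<le> sin (h + b) * sin (h - a)" using 1 s1 s3 unfolding eqs by simp
  have B: "(sin h)\<^sup>2 \<le> sin (h + a) * sin (h + b)" using 2 s2 s3 unfolding eqs by simp
  have pA: "sin (h + b) * sin (h - a) > 0" using A sh by (smt (verit) zero_less_power)
  show False
  proof (cases "sin (h + b) > 0")
    case True
    hence "sin (h - a) > 0" using pA by (simp add: zero_less_mult_iff)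
    hence ha: "h - a > 0" using bounds sin_ge_zero[of "a - h"] sin_minus[of "a - h"] by (smt (verit) minus_diff_eq)
    have "cos (a + b) \<le> 1" by simp
    moreover have "cos (2 * h - (a - b)) > cos (2 * h)"
      using bounds ha by (intro cos_monotone_0_pi) auto
    ultimately have "cos (a + b) - cos (2 * h - (a - b)) < 1 - cos (2 * h)" by linarith
    thus False using s1 s3 A by simp
  next
    case False
    hence neg: "sin (h + b) < 0" using pA by (cases "sin (h + b) = 0") auto
    have "h + b \<le> pi" using bounds by linarith
    hence "h + b < 0" using neg sin_ge_zero[of "h + b"] by (smt (verit))
    moreover have "sin (h + a) < 0"
      using B neg sh by (smt (verit) mult_nonneg_nonpos zero_less_power)
    hence "h + a > pi" using bounds sin_ge_zero[of "h + a"] by (smt (verit))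
    ultimately show False using bounds by auto
  qed
qed

text \<open>With e = \<epsilon> / 2 the squared norm is 1 + 4 sin e (sin e + sin (\<theta> - e)).
  Times r, the norm is the distance from one tangency point to the centre of another Larmor circle
  through the same P, when the directions from P to the centres differ by \<epsilon>.\<close>

lemma tangent_circles_interior:
  fixes \<epsilon> \<theta> :: real
  assumes "0 < \<epsilon>" "\<epsilon> \<le> pi" "0 < \<theta>" "\<theta> < pi"
  shows "norm (cis \<epsilon> - 1 + cis \<theta>) > 1"
proof -
  define e where "e = \<epsilon> / 2"
  have e: "\<epsilon> = 2 * e" "0 < e" "e \<le> pi / 2" using assms by (auto simp: e_def)
  have sh: "sin e > 0" using e by (intro sin_gt_zero) auto
  have sgt: "sin (\<theta> - e) > - sin e"
  proof (cases "\<theta> - e \<le> pi / 2")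
    case True
    have "sin (- e) < sin (\<theta> - e)" using True e assms by (intro sin_monotone_2pi) auto
    thus ?thesis by simp
  next
    case False
    hence "sin (\<theta> - e) > 0" using e assms by (intro sin_gt_zero) auto
    thus ?thesis using sh by simp
  qed
  have "cos (\<epsilon> - \<theta>) - cos \<theta> = 2 * sin e * sin (\<theta> - e)"
    unfolding e(1) by (simp add: cos_diff_cos algebra_simps)
  moreover have "1 - cos \<epsilon> = 2 * (sin e)\<^sup>2" unfolding e(1) by (simp add: cos_double_sin)
  ultimately have "1 - cos \<epsilon> + cos (\<epsilon> - \<theta>) - cos \<theta> = 2 * sin e * (sin e + sin (\<theta> - e))"
    by (simp add: algebra_simps power2_eq_square)
  also have "\<dots> > 0" using sh sgt by simp
  finally have pos: "1 - cos \<epsilon> + cos (\<epsilon> - \<theta>) - cos \<theta> > 0" .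
  have "(norm (cis \<epsilon> - 1 + cis \<theta>))\<^sup>2 = (cos \<epsilon> - 1 + cos \<theta>)\<^sup>2 + (sin \<epsilon> + sin \<theta>)\<^sup>2"
    by (simp add: cmod_power2)
  also have "\<dots> = 1 + 2 * (1 - cos \<epsilon> + cos (\<epsilon> - \<theta>) - cos \<theta>)"
  proof -
    have sin_sq: "sin t * sin t = 1 - cos t * cos t" for t :: real
      using sin_squared_eq[of t] by (simp add: power2_eq_square)
    show ?thesis by (simp add: cos_diff power2_eq_square algebra_simps sin_sq)
  qed
  finally have "(norm (cis \<epsilon> - 1 + cis \<theta>))\<^sup>2 > 1\<^sup>2" using pos by simp
  thus ?thesis by (rule power2_less_imp_less) simp
qed

subsection \<open>Smooth convex loops\<close>

text \<open>Positive where the tangent turns counterclockwise, as it does on every Larmor circle; so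
  \<beta> minus this is the right comparison for both orientations.\<close>

definition signed_curvature :: "(real \<Rightarrow> complex) \<Rightarrow> real \<Rightarrow> real" where
  "signed_curvature \<gamma> s = Im (cnj (tangent \<gamma> s) * vector_derivative (tangent \<gamma>) (at s))"

locale smooth_convex_loop =
  fixes \<gamma> :: "real \<Rightarrow> complex" and L :: real
  assumes scc: "smooth_closed_convex_curve \<gamma> L"
begin

abbreviation "\<tau> \<equiv> tangent \<gamma>"
abbreviation "\<kappa> \<equiv> signed_curvature \<gamma>"
abbreviation "region \<equiv> range \<gamma> \<union> inside (range \<gamma>)"

lemma L_pos: "L > 0" and periodic: "\<gamma> (s + L) = \<gamma> s" and smooth: "smooth_curve \<gamma>"
  and norm_tangent [simp]: "norm (\<tau> s) = 1" and simple: "simple_path (unit_interval_loop \<gamma> L)"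
  and convex_region: "convex region"
  using scc unfolding smooth_closed_convex_curve_def by blast+

lemma \<gamma>_deriv: "(\<gamma> has_vector_derivative \<tau> s) (at s)"
proof -
  obtain D where D: "D 0 = \<gamma>" "\<And>n s. (D n has_vector_derivative D (Suc n) s) (at s)"
    using smooth unfolding smooth_curve_def by blast
  have "(\<gamma> has_vector_derivative D 1 s) (at s)" using D(2)[of 0 s] D(1) by simp
  thus ?thesis unfolding tangent_def by (simp add: vector_derivative_at)
qed

lemma inner_tangent: "\<tau> s \<bullet> \<tau> s = 1" "(\<i> * \<tau> s) \<bullet> (\<i> * \<tau> s) = 1" "\<tau> s \<bullet> (\<i> * \<tau> s) = 0"
  "(\<i> * \<tau> s) \<bullet> \<tau> s = 0"
proof -
  show "\<tau> s \<bullet> \<tau> s = 1" by (simp add: dot_square_norm)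
  thus "(\<i> * \<tau> s) \<bullet> (\<i> * \<tau> s) = 1" by (simp add: inner_complex_def)
qed (simp_all add: inner_complex_def)

lemma tangent_frame: "z = of_real (z \<bullet> \<tau> s) * \<tau> s + of_real (z \<bullet> (\<i> * \<tau> s)) * (\<i> * \<tau> s)"
proof -
  define c d where "c = Re (\<tau> s)" and "d = Im (\<tau> s)"
  have cd: "c * c + d * d = 1" using inner_tangent(1)[of s] by (simp add: inner_complex_def c_def d_def)
  have "Re z = Re z * (c * c + d * d)" "Im z = Im z * (c * c + d * d)" by (simp_all add: cd)
  thus ?thesis by (simp add: complex_eq_iff inner_complex_def algebra_simps flip: c_def d_def)
qed

lemma frenet: "(\<tau> has_vector_derivative of_real (\<kappa> s) * (\<i> * \<tau> s)) (at s)"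
  and curvature_eq: "curvature \<gamma> s = \<bar>\<kappa> s\<bar>"
  and \<kappa>_smooth: "\<exists>\<kappa>'. continuous_on UNIV \<kappa>' \<and> (\<forall>s. (\<kappa> has_real_derivative \<kappa>' s) (at s))"
proof -
  obtain D where D: "D 0 = \<gamma>" "\<And>n s. (D n has_vector_derivative D (Suc n) s) (at s)"
    using smooth unfolding smooth_curve_def by blast
  have D1: "D 1 = \<tau>"
    using \<gamma>_deriv D(2)[of 0] D(1) vector_derivative_unique_at by fastforce
  have \<tau>': "(\<tau> has_vector_derivative D 2 s) (at s)" for s
    using D(2)[of 1 s] D1 by (simp add: numeral_2_eq_2)
  have vd: "vector_derivative \<tau> (at s) = D 2 s" for s by (rule vector_derivative_at[OF \<tau>'])
  have \<kappa>: "\<kappa> s = D 2 s \<bullet> (\<i> * \<tau> s)" for s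
    by (simp add: signed_curvature_def vd inner_complex_def algebra_simps)
  have "D 2 s \<bullet> \<tau> s = 0" for s
  proof -
    have "((\<lambda>t. (Re (\<tau> t))\<^sup>2 + (Im (\<tau> t))\<^sup>2) has_real_derivative
        2 * Re (\<tau> s) * Re (D 2 s) + 2 * Im (\<tau> s) * Im (D 2 s)) (at s)"
    proof -
      have R: "((\<lambda>t. Re (\<tau> t)) has_real_derivative Re (D 2 s)) (at s)"
        and I: "((\<lambda>t. Im (\<tau> t)) has_real_derivative Im (D 2 s)) (at s)"
        using has_vector_derivative_inner_right[OF \<tau>'[of s], of 1]
          has_vector_derivative_inner_right[OF \<tau>'[of s], of \<i>] by (simp_all add: inner_complex_def)
      show ?thesis
        by (rule DERIV_cong[OF DERIV_add[OF DERIV_power[OF R, of 2] DERIV_power[OF I, of 2]]]) simp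
    qed
    moreover have "(Re (\<tau> t))\<^sup>2 + (Im (\<tau> t))\<^sup>2 = 1" for t by (simp flip: cmod_power2)
    ultimately have "((\<lambda>t. 1) has_real_derivative 2 * Re (\<tau> s) * Re (D 2 s) + 2 * Im (\<tau> s) * Im (D 2 s)) (at s)"
      by simp
    hence "2 * Re (\<tau> s) * Re (D 2 s) + 2 * Im (\<tau> s) * Im (D 2 s) = 0"
      using DERIV_unique[OF _ DERIV_const] by blast
    thus ?thesis by (simp add: inner_complex_def algebra_simps)
  qed
  hence D2: "D 2 s = of_real (\<kappa> s) * (\<i> * \<tau> s)" for s
    using tangent_frame[of "D 2 s" s] by (simp add: \<kappa>)
  show "(\<tau> has_vector_derivative of_real (\<kappa> s) * (\<i> * \<tau> s)) (at s)" using \<tau>'[of s] D2 by simp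
  show "curvature \<gamma> s = \<bar>\<kappa> s\<bar>" unfolding curvature_def vd D2 by (simp add: norm_mult)
  have D2': "(D 2 has_vector_derivative D 3 s) (at s)" for s using D(2)[of 2 s] by (simp add: numeral_3_eq_3)
  have D3': "(D 3 has_vector_derivative D 4 s) (at s)" for s using D(2)[of 3 s] by (simp add: eval_nat_numeral)
  define \<kappa>' where "\<kappa>' s = D 3 s \<bullet> (\<i> * \<tau> s) + D 2 s \<bullet> (\<i> * D 2 s)" for s
  have "(\<kappa> has_real_derivative \<kappa>' s) (at s)" for s
  proof -
    have R: "((\<lambda>t. Re (\<tau> t)) has_real_derivative Re (D 2 s)) (at s)"
      and I: "((\<lambda>t. Im (\<tau> t)) has_real_derivative Im (D 2 s)) (at s)"
      and R2: "((\<lambda>t. Re (D 2 t)) has_real_derivative Re (D 3 s)) (at s)"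
      and I2: "((\<lambda>t. Im (D 2 t)) has_real_derivative Im (D 3 s)) (at s)"
      using has_vector_derivative_inner_right[OF \<tau>'[of s], of 1] has_vector_derivative_inner_right[OF \<tau>'[of s], of \<i>]
        has_vector_derivative_inner_right[OF D2'[of s], of 1] has_vector_derivative_inner_right[OF D2'[of s], of \<i>]
      by (simp_all add: inner_complex_def)
    have "((\<lambda>t. Im (D 2 t) * Re (\<tau> t) - Re (D 2 t) * Im (\<tau> t)) has_real_derivative \<kappa>' s) (at s)"
      by (rule DERIV_cong[OF DERIV_diff[OF DERIV_mult[OF I2 R] DERIV_mult[OF R2 I]]])
         (simp add: inner_complex_def \<kappa>'_def algebra_simps)
    moreover have "\<kappa> = (\<lambda>t. Im (D 2 t) * Re (\<tau> t) - Re (D 2 t) * Im (\<tau> t))"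
      by (auto simp: \<kappa> inner_complex_def)
    ultimately show ?thesis by simp
  qed
  moreover have "continuous_on UNIV \<kappa>'"
  proof -
    have "continuous_on UNIV \<tau>" "continuous_on UNIV (D 2)" "continuous_on UNIV (D 3)"
      using \<tau>' D2' D3' by (meson continuous_at_imp_continuous_on has_vector_derivative_continuous)+
    thus ?thesis unfolding \<kappa>'_def[abs_def] by (intro continuous_intros)
  qed
  ultimately show "\<exists>\<kappa>'. continuous_on UNIV \<kappa>' \<and> (\<forall>s. (\<kappa> has_real_derivative \<kappa>' s) (at s))" by blast
qed

lemma continuous_\<gamma>: "continuous_on S \<gamma>" and continuous_\<tau>: "continuous_on S \<tau>" and continuous_\<kappa>: "continuous_on S \<kappa>"
proof -
  show "continuous_on S \<gamma>" "continuous_on S \<tau>"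
    using \<gamma>_deriv frenet by (meson continuous_at_imp_continuous_on has_vector_derivative_continuous)+
  show "continuous_on S \<kappa>"
    using \<kappa>_smooth by (meson continuous_at_imp_continuous_on DERIV_isCont)
qed

lemma tangent_periodic: "\<tau> (s + L) = \<tau> s"
proof -
  have "((\<lambda>t. \<gamma> (t + L)) has_vector_derivative \<tau> (s + L)) (at s)"
    using vector_diff_chain_at[of "\<lambda>t. t + L" 1 s \<gamma> "\<tau> (s + L)"] \<gamma>_deriv[of "s + L"]
    by (simp add: o_def has_vector_derivative_add_const)
  hence "(\<gamma> has_vector_derivative \<tau> (s + L)) (at s)" by (simp add: periodic)
  thus ?thesis using \<gamma>_deriv vector_derivative_unique_at by blast
qed

text \<open>Stated for any L-periodic g because it also serves the parallel curve; s is moved to L *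
  frac (s / L).\<close>

lemma range_unit_interval_loop:
  assumes "\<And>s. g (s + L) = g s"
  shows "path_image (unit_interval_loop g L) = range g"
proof
  show "range g \<subseteq> path_image (unit_interval_loop g L)"
  proof
    fix z assume "z \<in> range g"
    then obtain s where z: "z = g s" by auto
    have per: "g (t + real n * L) = g t" for t n
    proof (induction n)
      case (Suc n)
      have "g (t + real (Suc n) * L) = g ((t + real n * L) + L)" by (simp add: algebra_simps)
      also have "\<dots> = g t" unfolding assms by (rule Suc)
      finally show ?case .
    qed simp
    have per': "g (t + of_int m * L) = g t" for t m
    proof (cases "m \<ge> 0")
      case True
      thus ?thesis using per[of t "nat m"] by simp
    next
      case False
      thus ?thesis using per[of "t + of_int m * L" "nat (- m)"] by (simp add: algebra_simps)
    qed
    define t where "t = frac (s / L)"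
    have "L * t + of_int \<lfloor>s / L\<rfloor> * L = s" using L_pos by (simp add: t_def frac_def field_simps)
    hence "g (L * t) = z" using per'[of "L * t" "\<lfloor>s / L\<rfloor>"] z by simp
    moreover have "t \<in> {0..1}" using frac_ge_0[of "s / L"] frac_lt_1[of "s / L"] by (simp add: t_def)
    ultimately show "z \<in> path_image (unit_interval_loop g L)"
      unfolding path_image_def unit_interval_loop_def by auto
  qed
qed (auto simp: path_image_def unit_interval_loop_def)

lemma loop_closed: "pathfinish (unit_interval_loop \<gamma> L) = pathstart (unit_interval_loop \<gamma> L)"
  using periodic[of 0] by (simp add: pathfinish_def pathstart_def unit_interval_loop_def)

lemma loop_image: "path_image (unit_interval_loop \<gamma> L) = range \<gamma>"
  by (rule range_unit_interval_loop) (rule periodic)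

lemmas Jordan = Jordan_inside_outside[OF simple loop_closed, unfolded loop_image]

text \<open>A supporting line of the convex region at \<gamma> s must be tangent, because its
  functional is minimal along the curve there. Its normal is thus a multiple of J\<tau>, by a factor
  \<mu> whose sign is still open. The inside is open, hence in the interior of the region, where the
  inequality is strict.\<close>

lemma supporting_normal:
  obtains \<mu> where "\<And>z. z \<in> region \<Longrightarrow> 0 \<le> \<mu> * ((z - \<gamma> s) \<bullet> (\<i> * \<tau> s))"
    "\<And>z. z \<in> inside (range \<gamma>) \<Longrightarrow> 0 < \<mu> * ((z - \<gamma> s) \<bullet> (\<i> * \<tau> s))"
proof -
  have int: "inside (range \<gamma>) \<subseteq> interior region"
    using Jordan by (intro interior_maximal) auto
  have ri: "rel_interior region = interior region"
    using int Jordan by (intro rel_interior_nonempty_interior) auto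
  \<comment> \<open>Points of the curve are limits of points of the outside.\<close>
  have "\<gamma> s \<notin> interior region"
  proof
    assume "\<gamma> s \<in> interior region"
    moreover have "\<gamma> s \<in> closure (outside (range \<gamma>))" using Jordan by (auto simp: frontier_def)
    ultimately have "interior region \<inter> closure (outside (range \<gamma>)) \<noteq> {}" by blast
    hence "interior region \<inter> outside (range \<gamma>) \<noteq> {}"
      by (simp only: open_Int_closure_eq_empty[OF open_interior] not_False_eq_True)
    moreover have "region \<inter> outside (range \<gamma>) = {}" using Jordan outside_no_overlap by blast
    ultimately show False using interior_subset by blast
  qed
  hence nri: "\<gamma> s \<notin> rel_interior region" using ri by simp
  have "\<gamma> s \<in> region" by simp
  obtain a where "a \<noteq> 0"
    and a: "\<And>z. z \<in> region \<Longrightarrow> a \<bullet> \<gamma> s \<le> a \<bullet> z"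
    "\<And>z. z \<in> rel_interior region \<Longrightarrow> a \<bullet> \<gamma> s < a \<bullet> z"
    by (rule supporting_hyperplane_rel_boundary[OF convex_region \<open>\<gamma> s \<in> region\<close> nri]) (rule that; blast)
  have "((\<lambda>t. \<gamma> t \<bullet> a) has_real_derivative \<tau> s \<bullet> a) (at s)"
    by (rule has_vector_derivative_inner_right[OF \<gamma>_deriv])
  hence "\<tau> s \<bullet> a = 0"
    by (rule DERIV_local_min[of _ _ _ 1]) (use a(1) in \<open>auto simp: inner_commute[of _ a]\<close>)
  hence a_eq: "a = of_real (a \<bullet> (\<i> * \<tau> s)) * (\<i> * \<tau> s)"
    using tangent_frame[of a s] by (simp add: inner_commute)
  have eq: "(z - \<gamma> s) \<bullet> a = (a \<bullet> (\<i> * \<tau> s)) * ((z - \<gamma> s) \<bullet> (\<i> * \<tau> s))" for z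
  proof -
    have "(z - \<gamma> s) \<bullet> a = (z - \<gamma> s) \<bullet> ((a \<bullet> (\<i> * \<tau> s)) *\<^sub>R (\<i> * \<tau> s))"
      using a_eq by (simp only: scaleR_conv_of_real)
    thus ?thesis by simp
  qed
  show ?thesis
  proof (rule that[of "a \<bullet> (\<i> * \<tau> s)"])
    show "0 \<le> (a \<bullet> (\<i> * \<tau> s)) * ((z - \<gamma> s) \<bullet> (\<i> * \<tau> s))" if "z \<in> region" for z
      unfolding eq[symmetric] using a(1)[OF that] by (simp add: inner_commute[of _ a] inner_diff_right)
    show "0 < (a \<bullet> (\<i> * \<tau> s)) * ((z - \<gamma> s) \<bullet> (\<i> * \<tau> s))" if "z \<in> inside (range \<gamma>)" for z
      unfolding eq[symmetric] using a(2)[of z] that ri int by (auto simp: inner_commute[of _ a] inner_diff_right)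
  qed
qed

lemma Im_tangent: "Im (\<tau> s * cnj (\<gamma> s - z)) = (z - \<gamma> s) \<bullet> (\<i> * \<tau> s)"
  by (simp add: inner_complex_def algebra_simps)

lemma loop_deriv: "(unit_interval_loop \<gamma> L has_vector_derivative of_real L * \<tau> (L * t)) (at t)"
proof -
  have "((\<lambda>t. L * t) has_vector_derivative L) (at t)" by (auto intro!: derivative_eq_intros)
  from vector_diff_chain_at[OF this \<gamma>_deriv] show ?thesis
    by (simp add: o_def unit_interval_loop_def scaleR_conv_of_real)
qed

lemma continuous_loop_deriv: "continuous_on UNIV (\<lambda>t. of_real L * \<tau> (L * t))"
  by (intro continuous_intros continuous_on_compose2[OF continuous_\<tau>[of UNIV]]) auto

text \<open>For a fixed inner point z0 the signed height over the tangent line at s is continuous in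
  s and never 0, so its sign is the same for all s. It is the sign of the angular velocity around
  z0, hence of the winding number.\<close>

lemma support_sign:
  obtains \<sigma> :: real where "\<sigma> = 1 \<or> \<sigma> = -1"
    "\<And>z s. z \<in> region \<Longrightarrow> 0 \<le> \<sigma> * ((z - \<gamma> s) \<bullet> (\<i> * \<tau> s))"
    "clockwise \<gamma> L \<Longrightarrow> \<sigma> = -1" "counterclockwise \<gamma> L \<Longrightarrow> \<sigma> = 1"
proof -
  obtain z0 where z0: "z0 \<in> inside (range \<gamma>)" using Jordan by blast
  define h where "h s = (z0 - \<gamma> s) \<bullet> (\<i> * \<tau> s)" for s
  have h0: "h s \<noteq> 0" for s
    using supporting_normal[of s] z0 unfolding h_def by (metis less_irrefl mult_zero_right)
  have cont: "continuous_on UNIV h"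
    unfolding h_def by (intro continuous_intros continuous_\<gamma> continuous_\<tau>)
  have con: "connected (range h)" by (rule connected_continuous_image[OF cont]) simp
  have sup: "0 \<le> h s * ((z - \<gamma> s) \<bullet> (\<i> * \<tau> s))" if z: "z \<in> region" for z s
  proof -
    obtain \<mu> where "0 \<le> \<mu> * ((z - \<gamma> s) \<bullet> (\<i> * \<tau> s))" "0 < \<mu> * h s"
      using supporting_normal[of s] z0 z unfolding h_def by metis
    thus ?thesis by (smt (verit) zero_le_mult_iff zero_less_mult_iff)
  qed
  consider "\<And>s. h s > 0" | "\<And>s. h s < 0"
  proof -
    have "False" if "h s > 0" "h t < 0" for s t
      using connectedD_interval[OF con, of "h t" "h s" 0] that h0 by auto
    thus ?thesis using that h0 by (metis linorder_neqE_linordered_idom)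
  qed
  thus ?thesis
  proof cases
    case 1
    show ?thesis
    proof (rule that[of 1])
      show "0 \<le> 1 * ((z - \<gamma> s) \<bullet> (\<i> * \<tau> s))" if "z \<in> region" for z s
        using sup[OF that, of s] 1[of s] by (simp add: zero_le_mult_iff)
      have "0 < Re (winding_number (unit_interval_loop \<gamma> L) z0)"
      proof (rule winding_number_sign_pos(2)[OF loop_deriv continuous_loop_deriv])
        show "0 < Im (of_real L * \<tau> (L * t) * cnj (unit_interval_loop \<gamma> L t - z0))" for t
          using Im_tangent[of "L * t" z0] 1[of "L * t"] L_pos
          by (simp add: unit_interval_loop_def h_def mult.assoc)
      qed
      thus "1 = (-1::real)" if "clockwise \<gamma> L" using that z0 by (auto simp: clockwise_def)
    qed auto
  next
    case 2
    show ?thesis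
    proof (rule that[of "-1"])
      show "0 \<le> (-1) * ((z - \<gamma> s) \<bullet> (\<i> * \<tau> s))" if "z \<in> region" for z s
        using sup[OF that, of s] 2[of s] by (auto simp: zero_le_mult_iff)
      have "Re (winding_number (unit_interval_loop \<gamma> L) z0) < 0"
      proof (rule winding_number_sign_neg(2)[OF loop_deriv continuous_loop_deriv])
        show "Im (of_real L * \<tau> (L * t) * cnj (unit_interval_loop \<gamma> L t - z0)) < 0" for t
          using Im_tangent[of "L * t" z0] 2[of "L * t"] L_pos
          by (simp add: unit_interval_loop_def h_def mult.assoc mult_pos_neg)
      qed
      thus "-1 = (1::real)" if "counterclockwise \<gamma> L" using that z0 by (auto simp: counterclockwise_def)
    qed auto
  qed
qed

text \<open>p is \<sigma> times the height over the tangent line at s. It is nonnegative along the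
  curve and has value and slope 0 at s, so its second derivative there cannot be negative.\<close>

lemma curvature_sign:
  assumes "\<And>z. z \<in> region \<Longrightarrow> 0 \<le> \<sigma> * ((z - \<gamma> s) \<bullet> (\<i> * \<tau> s))"
  shows "0 \<le> \<sigma> * \<kappa> s"
proof (rule ccontr)
  assume "\<not> 0 \<le> \<sigma> * \<kappa> s"
  define p where "p t = \<sigma> * ((\<gamma> t - \<gamma> s) \<bullet> (\<i> * \<tau> s))" for t
  define q where "q t = \<sigma> * (\<tau> t \<bullet> (\<i> * \<tau> s))" for t
  have p': "(p has_real_derivative q t) (at t)" for t
  proof -
    have "((\<lambda>t. \<gamma> t - \<gamma> s) has_vector_derivative \<tau> t) (at t)"
      using has_vector_derivative_diff[OF \<gamma>_deriv has_vector_derivative_const] by simp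
    from DERIV_cmult[OF has_vector_derivative_inner_right[OF this]]
    show ?thesis unfolding p_def[abs_def] q_def .
  qed
  have "(q has_real_derivative \<sigma> * ((of_real (\<kappa> s) * (\<i> * \<tau> s)) \<bullet> (\<i> * \<tau> s))) (at s)"
    unfolding q_def[abs_def] by (intro DERIV_cmult has_vector_derivative_inner_right frenet)
  also have "(of_real (\<kappa> s) * (\<i> * \<tau> s)) \<bullet> (\<i> * \<tau> s) = \<kappa> s"
    using inner_tangent(2)[of s] by (simp flip: scaleR_conv_of_real)
  finally obtain d where d: "d > 0" "\<And>h. 0 < h \<Longrightarrow> h < d \<Longrightarrow> q (s + h) < q s"
    using DERIV_neg_dec_right[of q "\<sigma> * \<kappa> s" s] \<open>\<not> 0 \<le> \<sigma> * \<kappa> s\<close> by auto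
  have "s < s + d / 2" using d(1) by simp
  from MVT2[OF this p'] obtain z where z: "s < z" "z < s + d / 2" "p (s + d / 2) - p s = (s + d / 2 - s) * q z"
    by blast
  have "q z < q s" using d(2)[of "z - s"] z d(1) by simp
  also have "q s = 0" by (simp add: q_def inner_tangent)
  finally have "d / 2 * q z < 0" using d(1) by (simp add: mult_pos_neg)
  hence "p (s + d / 2) < p s" using z(3) by simp
  moreover have "p s = 0" by (simp add: p_def)
  moreover have "p (s + d / 2) \<ge> 0" unfolding p_def by (rule assms) auto
  ultimately show False by simp
qed

end

section \<open>Tangent angle and rolling inside Larmor discs\<close>

context smooth_convex_loop
begin

text \<open>Integrate \<kappa> to \<phi>0; by Frenet's equation \<tau> times cis of -\<phi>0 is
  constant, and the argument of this constant is the additive constant to be adjusted.\<close>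

lemma angle_function:
  assumes "a < b"
  obtains \<phi> where "\<And>t. t \<in> {a<..<b} \<Longrightarrow> (\<phi> has_real_derivative \<kappa> t) (at t)"
    "\<And>t. t \<in> {a<..<b} \<Longrightarrow> \<tau> t = cis (\<phi> t)"
proof -
  obtain \<phi>0 where "\<And>t. t \<in> {a..b} \<Longrightarrow> (\<phi>0 has_vector_derivative \<kappa> t) (at t within {a..b})"
    using antiderivative_continuous[OF continuous_\<kappa>[of "{a..b}"]] by blast
  hence \<phi>0: "(\<phi>0 has_vector_derivative \<kappa> t) (at t)" if "t \<in> {a<..<b}" for t
    using that by (metis at_within_Icc_at greaterThanLessThan_iff atLeastAtMost_iff less_imp_le)
  have cis': "((\<lambda>t. cis (- \<phi>0 t)) has_vector_derivative of_real (- \<kappa> t) * (\<i> * cis (- \<phi>0 t))) (at t)"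
    if "t \<in> {a<..<b}" for t
  proof -
    have "((\<lambda>x. cis (- x)) has_vector_derivative - (\<i> * cis (- \<phi>0 t))) (at (\<phi>0 t))"
    proof -
      have "((\<lambda>z. exp (- (\<i> * z))) has_field_derivative - (\<i> * exp (- (\<i> * of_real (\<phi>0 t))))) (at (of_real (\<phi>0 t)))"
        by (auto intro!: derivative_eq_intros)
      from has_vector_derivative_real_field[OF this] show ?thesis by (simp add: cis_conv_exp)
    qed
    from vector_diff_chain_at[OF \<phi>0[OF that] this] show ?thesis by (simp add: o_def scaleR_conv_of_real)
  qed
  define F where "F t = \<tau> t * cis (- \<phi>0 t)" for t
  have zero: "(F has_vector_derivative 0) (at t within {a<..<b})" if "t \<in> {a<..<b}" for t
  proof -
    have "(F has_vector_derivative 0) (at t)"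
      using has_vector_derivative_mult[OF frenet cis'[OF that]] unfolding F_def[abs_def]
      by (simp add: algebra_simps)
    thus ?thesis by (rule has_vector_derivative_at_within)
  qed
  obtain c where "\<And>t. t \<in> {a<..<b} \<Longrightarrow> F t = c"
    using has_vector_derivative_zero_constant[of "{a<..<b}" F] zero by (metis convex_real_interval(8))
  hence c: "\<tau> t * cis (- \<phi>0 t) = c" if "t \<in> {a<..<b}" for t using that by (simp add: F_def)
  have "norm c = 1"
  proof -
    have "(a + b) / 2 \<in> {a<..<b}" using assms by auto
    from c[OF this] have "norm (\<tau> ((a + b) / 2) * cis (- \<phi>0 ((a + b) / 2))) = norm c" by simp
    thus ?thesis by (simp add: norm_mult)
  qed
  hence carg: "cis (Arg c) = c" using cis_Arg[of c] by (metis div_by_1 norm_zero of_real_1 sgn_eq zero_neq_one)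
  show ?thesis
  proof (rule that[of "\<lambda>t. \<phi>0 t + Arg c"])
    show "((\<lambda>t. \<phi>0 t + Arg c) has_real_derivative \<kappa> t) (at t)" if "t \<in> {a<..<b}" for t
      using \<phi>0[OF that] by (auto intro!: derivative_eq_intros simp: has_real_derivative_iff_has_vector_derivative[symmetric])
    show "\<tau> t = cis (\<phi>0 t + Arg c)" if "t \<in> {a<..<b}" for t
    proof -
      have "cis (\<phi>0 t + Arg c) = cis (\<phi>0 t) * (\<tau> t * cis (- \<phi>0 t))" by (simp add: carg c[OF that] flip: cis_mult)
      also have "\<dots> = \<tau> t * (cis (\<phi>0 t) * cis (- \<phi>0 t))" by (simp add: mult_ac)
      finally show ?thesis by (simp add: cis_mult)
    qed
  qed
qed

text \<open>
  Blaschke's rolling theorem. The distance from the centre is the maximum of the support function,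
  and turning the tangent by at most \<open>\<pi>\<close> from \<open>s\<close> reaches every direction.
\<close>

lemma rolling:
  assumes sup: "\<And>z s. z \<in> region \<Longrightarrow> 0 \<le> (z - \<gamma> s) \<bullet> (\<i> * \<tau> s)"
    and \<beta>: "\<beta> > 0" "\<And>s. \<beta> < \<kappa> s" and ne: "\<gamma> s' \<noteq> \<gamma> s"
  shows "norm (\<gamma> s' - larmor_center \<gamma> \<beta> s) < 1 / \<beta>"
proof -
  define r where "r = 1 / \<beta>"
  have r: "r > 0" "\<And>s. r * \<kappa> s > 1" using \<beta> by (auto simp: r_def field_simps)
  define C where "C t = \<gamma> t + of_real r * (\<i> * \<tau> t)" for t
  have C: "larmor_center \<gamma> \<beta> s = C s" by (simp add: C_def larmor_center_def parallel_curve_def r_def)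
  have C': "(C has_vector_derivative of_real (1 - r * \<kappa> t) * \<tau> t) (at t)" for t
  proof -
    have "(C has_vector_derivative \<tau> t + of_real r * (\<i> * (of_real (\<kappa> t) * (\<i> * \<tau> t)))) (at t)"
      unfolding C_def[abs_def]
      by (intro has_vector_derivative_add has_vector_derivative_mult_right \<gamma>_deriv frenet)
    moreover have "\<tau> t + of_real r * (\<i> * (of_real (\<kappa> t) * (\<i> * \<tau> t))) = of_real (1 - r * \<kappa> t) * \<tau> t"
      by (simp add: algebra_simps flip: mult.assoc[of \<i> \<i>])
    ultimately show ?thesis by simp
  qed
  show ?thesis
  proof (cases "\<gamma> s' = C s")
    case True
    thus ?thesis using r(1) by (simp add: C r_def)
  next
    case False
    define d where "d = norm (\<gamma> s' - C s)"
    have d: "d > 0" using False by (simp add: d_def)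
    define u where "u = (\<gamma> s' - C s) / of_real d"
    have u: "norm u = 1" "\<gamma> s' - C s = of_real d * u" using d by (simp_all add: u_def d_def norm_divide)
    \<comment> \<open>As \<kappa> > \<beta>, the tangent turns by more than pi over a parameter
      length pi / \<beta>. The radius 2 R keeps the closed interval [s - R, s + R] inside the open
      domain of \<phi>.\<close>
    define R where "R = pi / \<beta>"
    have R: "R > 0" using \<beta> by (simp add: R_def)
    have sR: "s - 2 * R < s + 2 * R" using R by simp
    obtain \<phi> where \<phi>': "\<And>t. t \<in> {s - 2 * R<..<s + 2 * R} \<Longrightarrow> (\<phi> has_real_derivative \<kappa> t) (at t)"
      and \<phi>: "\<And>t. t \<in> {s - 2 * R<..<s + 2 * R} \<Longrightarrow> \<tau> t = cis (\<phi> t)"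
      by (rule angle_function[OF sR]) (rule that; blast)
    have grow: "(t' - t) * \<beta> < \<phi> t' - \<phi> t" if "t < t'" "s - R \<le> t" "t' \<le> s + R" for t t'
    proof -
      have "(\<phi> has_real_derivative \<kappa> v) (at v)" if "t \<le> v" "v \<le> t'" for v
        by (rule \<phi>') (use that \<open>s - R \<le> t\<close> \<open>t' \<le> s + R\<close> R in auto)
      from MVT2[OF that(1) this] obtain v where "\<phi> t' - \<phi> t = (t' - t) * \<kappa> v" by blast
      thus ?thesis using \<beta>(2)[of v] that(1) by simp
    qed
    \<comment> \<open>\<i> * u is the tangent direction whose outward normal is u, and \<delta> is
      the turning needed to reach it from s.\<close>
    define \<delta> where "\<delta> = Arg (\<i> * u / \<tau> s)"
    have \<delta>: "- pi < \<delta>" "\<delta> \<le> pi" using Arg_bounded[of "\<i> * u / \<tau> s"] by (simp_all add: \<delta>_def)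
    have "norm (\<i> * u / \<tau> s) = 1" by (simp add: norm_divide norm_mult u)
    hence "cis \<delta> = \<i> * u / \<tau> s"
      using cis_Arg[of "\<i> * u / \<tau> s"] by (metis \<delta>_def div_by_1 norm_zero of_real_1 sgn_eq zero_neq_one)
    moreover have "\<tau> s \<noteq> 0" using norm_tangent[of s] by (metis norm_zero zero_neq_one)
    ultimately have iu: "cis (\<phi> s + \<delta>) = \<i> * u" using \<phi>[of s] R by (simp add: cis_mult[symmetric])
    have Rb: "R * \<beta> = pi" using \<beta> by (simp add: R_def)
    have cont: "continuous_on {s - R..s + R} \<phi>"
      by (rule DERIV_continuous_on[of _ _ \<kappa>], rule has_field_derivative_at_within, rule \<phi>') (use R in auto)
    have "\<phi> (s - R) \<le> \<phi> s + \<delta>" "\<phi> s + \<delta> \<le> \<phi> (s + R)"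
      using grow[of "s - R" s] grow[of s "s + R"] R \<delta> Rb by auto
    then obtain \<sigma> where \<sigma>: "s - R \<le> \<sigma>" "\<sigma> \<le> s + R" "\<phi> \<sigma> = \<phi> s + \<delta>"
      using IVT'[of \<phi> "s - R" "\<phi> s + \<delta>" "s + R"] cont R by auto
    have u\<sigma>: "u = - (\<i> * \<tau> \<sigma>)" using iu \<phi>[of \<sigma>] \<sigma> R by (simp add: mult.assoc[symmetric])
    \<comment> \<open>At \<sigma> the outward normal is u, so \<gamma> \<sigma> maximizes the inner
      product with u along the curve.\<close>
    have "d = (\<gamma> s' - C s) \<bullet> u"
    proof -
      have "(\<gamma> s' - C s) \<bullet> u = (d *\<^sub>R u) \<bullet> u" unfolding u(2) by (simp only: scaleR_conv_of_real)
      thus ?thesis using u(1) by (simp add: dot_square_norm)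
    qed
    also have "\<dots> = (\<gamma> s' - \<gamma> \<sigma>) \<bullet> u + (\<gamma> \<sigma> - C s) \<bullet> u" by (simp add: inner_diff_left)
    also have "\<dots> \<le> (\<gamma> \<sigma> - C s) \<bullet> u" using sup[of "\<gamma> s'" \<sigma>] by (simp add: u\<sigma>)
    finally have le: "d \<le> (\<gamma> \<sigma> - C s) \<bullet> u" .
    show ?thesis
    proof (cases "\<sigma> = s")
      case True
      have rS: "\<gamma> s - C s = r *\<^sub>R u" using u\<sigma> True by (simp add: C_def scaleR_conv_of_real)
      hence "d \<le> r" using le True u(1) by (simp add: dot_square_norm)
      moreover have "d \<noteq> r"
      proof
        assume "d = r"
        hence "\<gamma> s' - C s = \<gamma> s - C s" using rS u(2) by (simp add: scaleR_conv_of_real)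
        thus False using ne by simp
      qed
      ultimately show ?thesis by (simp add: C d_def r_def)
    next
      case False
      \<comment> \<open>The centres are projected on u. Their velocity is (1 - r \<kappa>) \<tau>
        with r \<kappa> > 1, and the component of \<tau> along u keeps its sign between s and
        \<sigma>, so C \<sigma> lies strictly behind C s. Since \<gamma> \<sigma> is only r ahead of
        C \<sigma>, this gives d < r.\<close>
      define \<psi> where "\<psi> t = C t \<bullet> u" for t
      have \<psi>': "(\<psi> has_real_derivative (1 - r * \<kappa> t) * sin (\<phi> \<sigma> - \<phi> t)) (at t)" if t: "s - R \<le> t" "t \<le> s + R" for t
      proof -
        have "(\<psi> has_real_derivative (of_real (1 - r * \<kappa> t) * \<tau> t) \<bullet> u) (at t)"
          unfolding \<psi>_def[abs_def] by (rule has_vector_derivative_inner_right[OF C'])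
        also have "(of_real (1 - r * \<kappa> t) * \<tau> t) \<bullet> u = (1 - r * \<kappa> t) * (\<tau> t \<bullet> u)"
          by (simp only: scaleR_conv_of_real[symmetric] inner_scaleR_left)
        also have "\<tau> t \<bullet> u = sin (\<phi> \<sigma> - \<phi> t)"
          using \<phi>[of t] \<phi>[of \<sigma>] t \<sigma> R by (simp add: u\<sigma> inner_complex_def sin_diff algebra_simps)
        finally show ?thesis .
      qed
      have "\<psi> \<sigma> < \<psi> s"
      proof (cases "s < \<sigma>")
        case True
        obtain t where t: "s < t" "t < \<sigma>" "\<psi> \<sigma> - \<psi> s = (\<sigma> - s) * ((1 - r * \<kappa> t) * sin (\<phi> \<sigma> - \<phi> t))"
          using MVT2[OF True \<psi>'] \<sigma> R by force
        have "0 < \<phi> \<sigma> - \<phi> t" "\<phi> s < \<phi> t"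
          using grow[of t \<sigma>] grow[of s t] t \<sigma> R \<beta>(1) by (smt (verit) mult_pos_pos)+
        hence "sin (\<phi> \<sigma> - \<phi> t) > 0" using \<sigma>(3) \<delta> by (intro sin_gt_zero) auto
        hence "(1 - r * \<kappa> t) * sin (\<phi> \<sigma> - \<phi> t) < 0" using r(2)[of t] by (simp add: mult_neg_pos)
        hence "(\<sigma> - s) * ((1 - r * \<kappa> t) * sin (\<phi> \<sigma> - \<phi> t)) < 0"
          using True mult_pos_neg[of "\<sigma> - s"] by simp
        thus ?thesis using t(3) by simp
      next
        case nlt: False
        hence lt: "\<sigma> < s" using False by simp
        obtain t where t: "\<sigma> < t" "t < s" "\<psi> s - \<psi> \<sigma> = (s - \<sigma>) * ((1 - r * \<kappa> t) * sin (\<phi> \<sigma> - \<phi> t))"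
          using MVT2[OF lt \<psi>'] \<sigma> R by force
        have "0 < \<phi> t - \<phi> \<sigma>" "\<phi> t < \<phi> s"
          using grow[of \<sigma> t] grow[of t s] t \<sigma> R \<beta>(1) by (smt (verit) mult_pos_pos)+
        hence "sin (\<phi> t - \<phi> \<sigma>) > 0" using \<sigma>(3) \<delta> by (intro sin_gt_zero) auto
        hence "sin (\<phi> \<sigma> - \<phi> t) < 0" using sin_minus[of "\<phi> t - \<phi> \<sigma>"] by simp
        hence "(1 - r * \<kappa> t) * sin (\<phi> \<sigma> - \<phi> t) > 0" using r(2)[of t] by (simp add: mult_neg_neg)
        hence "(s - \<sigma>) * ((1 - r * \<kappa> t) * sin (\<phi> \<sigma> - \<phi> t)) > 0" using lt by simp
        thus ?thesis using t(3) by simp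
      qed
      moreover have "C \<sigma> \<bullet> u = \<gamma> \<sigma> \<bullet> u - r"
      proof -
        have "C \<sigma> = \<gamma> \<sigma> - r *\<^sub>R u" by (simp add: C_def u\<sigma> scaleR_conv_of_real)
        thus ?thesis using u(1) by (simp add: inner_diff_left dot_square_norm)
      qed
      ultimately have "d < r" using le by (simp add: \<psi>_def inner_diff_left)
      thus ?thesis by (simp add: C d_def r_def)
    qed
  qed
qed

end

subsection \<open>The billiard map\<close>

lemma eval2_of_real_polynomial_function:
  assumes "real_polynomial_function F"
  obtains h where "\<And>z::complex. F z = eval2 h (Re z) (Im z)"
proof -
  have "\<exists>h. \<forall>z::complex. F z = eval2 h (Re z) (Im z)"
    using assms
  proof induction
    case (linear f)
    have "f z = eval2 [:[:0, f 1:], [:f \<i>:]:] (Re z) (Im z)" for z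
    proof -
      have "f z = f (Re z *\<^sub>R 1 + Im z *\<^sub>R \<i>)"
        by (rule arg_cong[of _ _ f]) (simp add: complex_eq_iff)
      also have "\<dots> = Re z * f 1 + Im z * f \<i>"
        by (simp add: linear_add linear_scale bounded_linear.linear[OF linear])
      finally show ?thesis by simp
    qed
    thus ?case by blast
  next
    case (const c)
    show ?case by (rule exI[of _ "[:[:c:]:]"]) simp
  next
    case (add f g)
    then obtain p q where "\<forall>z. f z = eval2 p (Re z) (Im z)" "\<forall>z. g z = eval2 q (Re z) (Im z)" by blast
    thus ?case by (intro exI[of _ "p + q"]) simp
  next
    case (mult f g)
    then obtain p q where "\<forall>z. f z = eval2 p (Re z) (Im z)" "\<forall>z. g z = eval2 q (Re z) (Im z)" by blast
    thus ?case by (intro exI[of _ "p * q"]) simp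
  qed
  thus ?thesis using that by blast
qed

lemma cis_inner: "(cis x * z) \<bullet> (cis y * z) = (norm z)\<^sup>2 * cos (x - y)"
proof -
  show ?thesis unfolding cmod_power2 by (simp add: inner_complex_def cos_diff power2_eq_square algebra_simps)
qed

section \<open>Uniqueness of the image point and evenness on Larmor circles\<close>

context smooth_convex_loop
begin

lemma larmor_point_eq:
  "larmor_point \<gamma> \<beta> s \<theta> = larmor_center \<gamma> \<beta> s - of_real (1 / \<beta>) * (cis \<theta> * (\<i> * \<tau> s))"
  by (simp add: larmor_point_def larmor_center_def parallel_curve_def algebra_simps)

lemma larmor_center_eq: "larmor_center \<gamma> \<beta> s = \<gamma> s + of_real (1 / \<beta>) * (\<i> * \<tau> s)"
  by (simp add: larmor_center_def parallel_curve_def)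

text \<open>The curve lies to the right of each of its tangents, so neither tangency point is on the
  normal side of the other's tangent line. This forces equal normals, then equal angles, then equal
  tangency points.\<close>

lemma larmor_point_unique_exterior:
  assumes sup: "\<And>z s. z \<in> region \<Longrightarrow> (z - \<gamma> s) \<bullet> (\<i> * \<tau> s) \<le> 0" and \<beta>: "\<beta> > 0"
    and \<theta>: "0 < \<theta>" "\<theta> < pi" "0 < \<theta>'" "\<theta>' < pi"
    and eq: "larmor_point \<gamma> \<beta> s (- \<theta>) = larmor_point \<gamma> \<beta> s' (- \<theta>')"
  shows "larmor_point \<gamma> \<beta> s \<theta> = larmor_point \<gamma> \<beta> s' \<theta>'"
proof -
  define r where "r = 1 / \<beta>"
  have r: "r > 0" using \<beta> by (simp add: r_def)
  define n n' where "n = \<i> * \<tau> s" and "n' = \<i> * \<tau> s'"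
  have norm_n: "norm n = 1" "norm n' = 1" by (simp_all add: n_def n'_def norm_mult)
  hence n0: "n \<noteq> 0" by auto
  define \<delta> where "\<delta> = Arg (n' / n)"
  have \<delta>: "- pi < \<delta>" "\<delta> \<le> pi" using Arg_bounded by (simp_all add: \<delta>_def)
  have "norm (n' / n) = 1" by (simp add: norm_divide norm_n)
  hence "cis \<delta> = n' / n"
    using cis_Arg[of "n' / n"] by (metis \<delta>_def div_by_1 norm_zero of_real_1 sgn_eq zero_neq_one)
  hence n': "n' = cis \<delta> * n" using n0 by simp
  have diff: "\<gamma> s' - \<gamma> s = r *\<^sub>R ((n - n') - (cis (- \<theta>) * n - cis (- \<theta>') * n'))"
    using eq by (simp add: larmor_point_eq larmor_center_eq scaleR_conv_of_real algebra_simps flip: n_def n'_def r_def)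
  have e: "((n - n') - (cis (- \<theta>) * n - cis (- \<theta>') * n')) \<bullet> n = 1 - cos \<delta> - cos \<theta> + cos (\<delta> - \<theta>')"
  proof -
    have "((n - n') - (cis (- \<theta>) * n - cis (- \<theta>') * n')) \<bullet> n =
      (cis 0 * n) \<bullet> (cis 0 * n) - (cis \<delta> * n) \<bullet> (cis 0 * n) - (cis (- \<theta>) * n) \<bullet> (cis 0 * n)
        + (cis (\<delta> - \<theta>') * n) \<bullet> (cis 0 * n)"
      by (simp add: n' inner_diff_left cis_mult mult.assoc[symmetric] add.commute)
    thus ?thesis unfolding cis_inner by (simp add: norm_n)
  qed
  have e': "((n - n') - (cis (- \<theta>) * n - cis (- \<theta>') * n')) \<bullet> n' = - (1 - cos \<delta> - cos \<theta>' + cos (\<delta> + \<theta>))"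
  proof -
    have "((n - n') - (cis (- \<theta>) * n - cis (- \<theta>') * n')) \<bullet> n' =
      (cis 0 * n) \<bullet> (cis \<delta> * n) - (cis \<delta> * n) \<bullet> (cis \<delta> * n) - (cis (- \<theta>) * n) \<bullet> (cis \<delta> * n)
        + (cis (\<delta> - \<theta>') * n) \<bullet> (cis \<delta> * n)"
      by (simp add: n' inner_diff_left cis_mult mult.assoc[symmetric] add.commute)
    moreover have "cos (- \<theta> - \<delta>) = cos (\<delta> + \<theta>)"
      by (metis cos_minus minus_add_distrib add.commute uminus_add_conv_diff diff_conv_add_uminus)
    ultimately show ?thesis unfolding cis_inner by (simp add: norm_n)
  qed
  have "(\<gamma> s' - \<gamma> s) \<bullet> n \<le> 0" "0 \<le> (\<gamma> s' - \<gamma> s) \<bullet> n'"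
    using sup[of "\<gamma> s'" s] sup[of "\<gamma> s" s'] by (simp_all add: n_def n'_def inner_diff_left)
  hence 1: "1 - cos \<delta> + cos (\<delta> - \<theta>') \<le> cos \<theta>" and 2: "1 - cos \<delta> + cos (\<delta> + \<theta>) \<le> cos \<theta>'"
    unfolding diff inner_scaleR_left e e' using r by (auto simp: mult_le_0_iff zero_le_mult_iff)
  have "\<delta> = 0"
  proof (rule ccontr)
    assume "\<delta> \<noteq> 0"
    then consider "\<delta> > 0" | "- \<delta> > 0" by linarith
    thus False
    proof cases
      case pos: 1
      show False by (rule tangent_circles_exterior[OF \<theta> pos \<delta>(2) 1 2])
    next
      \<comment> \<open>Negative \<delta> is the same configuration with the two circles
        exchanged.\<close>
      case neg: 2
      have "1 - cos (- \<delta>) + cos (- \<delta> - \<theta>) \<le> cos \<theta>'" "1 - cos (- \<delta>) + cos (- \<delta> + \<theta>') \<le> cos \<theta>"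
        using 1 2 cos_minus[of "\<delta> + \<theta>"] cos_minus[of "\<delta> - \<theta>'"] by (simp_all add: algebra_simps)
      with tangent_circles_exterior[OF \<theta>(3,4,1,2) neg] \<delta> show False by simp
    qed
  qed
  hence "n' = n" "cos \<theta> = cos \<theta>'" using n' 1 2 by auto
  hence "\<theta> = \<theta>'" using \<theta> cos_inj_pi[of \<theta> \<theta>'] by simp
  hence "\<gamma> s' = \<gamma> s" using diff \<open>n' = n\<close> by simp
  thus ?thesis using \<open>n' = n\<close> \<open>\<theta> = \<theta>'\<close>
    by (simp add: larmor_point_eq larmor_center_eq n_def n'_def)
qed

text \<open>Every closed Larmor disc contains the whole curve, whereas of two distinct tangent
  circles through P one would have its tangency point outside the disc of the other.\<close>

lemma larmor_point_unique_interior: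
  assumes roll: "\<And>s s'. \<gamma> s' \<noteq> \<gamma> s \<Longrightarrow> norm (\<gamma> s' - larmor_center \<gamma> \<beta> s) < 1 / \<beta>" and \<beta>: "\<beta> > 0"
    and \<theta>: "0 < \<theta>" "\<theta> < pi" "0 < \<theta>'" "\<theta>' < pi"
    and eq: "larmor_point \<gamma> \<beta> s (- \<theta>) = larmor_point \<gamma> \<beta> s' (- \<theta>')"
  shows "larmor_point \<gamma> \<beta> s \<theta> = larmor_point \<gamma> \<beta> s' \<theta>'"
proof -
  define r where "r = 1 / \<beta>"
  have r: "r > 0" using \<beta> by (simp add: r_def)
  define C C' where "C = larmor_center \<gamma> \<beta> s" and "C' = larmor_center \<gamma> \<beta> s'"
  \<comment> \<open>Unit vectors from the common point P to the two centres; \<epsilon> below is the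
    angle between them.\<close>
  define v v' where "v = cis (- \<theta>) * (\<i> * \<tau> s)" and "v' = cis (- \<theta>') * (\<i> * \<tau> s')"
  have norm_v: "norm v = 1" "norm v' = 1" by (simp_all add: v_def v'_def norm_mult)
  hence v0: "v \<noteq> 0" by auto
  have n: "\<i> * \<tau> s = cis \<theta> * v" "\<i> * \<tau> s' = cis \<theta>' * v'"
    by (simp_all add: v_def v'_def mult.assoc[symmetric] cis_mult)
  have A: "\<gamma> s = C - of_real r * (cis \<theta> * v)" "\<gamma> s' = C' - of_real r * (cis \<theta>' * v')"
    by (simp_all add: C_def C'_def larmor_center_eq r_def flip: n)
  have CC: "C' - C = of_real r * (v' - v)"
    using eq by (simp add: larmor_point_eq C_def C'_def v_def v'_def r_def algebra_simps)
  have roll': "norm (\<gamma> t' - larmor_center \<gamma> \<beta> t) \<le> r" for t t'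
  proof (cases "\<gamma> t' = \<gamma> t")
    case True
    hence "\<gamma> t' - larmor_center \<gamma> \<beta> t = - (of_real r * (\<i> * \<tau> t))" by (simp add: larmor_center_eq r_def)
    thus ?thesis using r by (simp add: norm_mult)
  next
    case False
    from roll[OF this] show ?thesis by (simp add: r_def)
  qed
  define \<epsilon> where "\<epsilon> = Arg (v' / v)"
  have \<epsilon>: "- pi < \<epsilon>" "\<epsilon> \<le> pi" using Arg_bounded by (simp_all add: \<epsilon>_def)
  have "norm (v' / v) = 1" by (simp add: norm_divide norm_v)
  hence "cis \<epsilon> = v' / v"
    using cis_Arg[of "v' / v"] by (metis \<epsilon>_def div_by_1 norm_zero of_real_1 sgn_eq zero_neq_one)
  hence v': "v' = cis \<epsilon> * v" using v0 by simp
  have v: "v = cis (- \<epsilon>) * v'" by (simp add: v' mult.assoc[symmetric] cis_mult)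
  have "\<epsilon> = 0"
  proof (rule ccontr)
    assume "\<epsilon> \<noteq> 0"
    then consider "\<epsilon> > 0" | "- \<epsilon> > 0" by linarith
    thus False
    proof cases
      \<comment> \<open>Here \<gamma> s falls outside the disc around C'; in the other case \<gamma>
        s' falls outside the disc around C.\<close>
      case 1
      have "C' - \<gamma> s = of_real r * ((cis \<epsilon> - 1 + cis \<theta>) * v)"
      proof -
        have "C' - \<gamma> s = (C' - C) + (C - \<gamma> s)" by simp
        also have "\<dots> = of_real r * ((cis \<epsilon> - 1 + cis \<theta>) * v)" unfolding CC A(1) v' by (simp add: algebra_simps)
        finally show ?thesis .
      qed
      hence "norm (C' - \<gamma> s) = r * norm (cis \<epsilon> - 1 + cis \<theta>)" using r by (simp add: norm_mult norm_v)
      moreover have "norm (C' - \<gamma> s) \<le> r * 1" using roll'[of s s'] by (simp add: C'_def norm_minus_commute)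
      ultimately show False using tangent_circles_interior[OF 1 \<epsilon>(2) \<theta>(1,2)] r by simp
    next
      case 2
      have "C - \<gamma> s' = of_real r * ((cis (- \<epsilon>) - 1 + cis \<theta>') * v')"
      proof -
        have "v' - v = (1 - cis (- \<epsilon>)) * v'" by (subst v) (simp add: algebra_simps)
        hence "C' - C = of_real r * ((1 - cis (- \<epsilon>)) * v')" using CC by simp
        moreover have "C - \<gamma> s' = (C' - \<gamma> s') - (C' - C)" by simp
        ultimately have "C - \<gamma> s' = (C' - \<gamma> s') - of_real r * ((1 - cis (- \<epsilon>)) * v')" by simp
        also have "\<dots> = of_real r * ((cis (- \<epsilon>) - 1 + cis \<theta>') * v')"
          unfolding A(2) by (simp add: algebra_simps)
        finally show ?thesis .
      qed
      hence "norm (C - \<gamma> s') = r * norm (cis (- \<epsilon>) - 1 + cis \<theta>')"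
        using r by (simp add: norm_mult norm_v)
      moreover have "norm (C - \<gamma> s') \<le> r * 1" using roll'[of s' s] by (simp add: C_def norm_minus_commute)
      ultimately show False using tangent_circles_interior[OF 2 _ \<theta>(3,4)] \<epsilon>(1) r by simp
    qed
  qed
  hence vv: "v' = v" using v' by simp
  hence "C' = C" using CC by simp
  have norm_A: "norm (\<gamma> s' - C) = r"
    using r by (simp add: A(2) \<open>C' = C\<close> norm_mult norm_v)
  have "\<gamma> s' = \<gamma> s"
  proof (rule ccontr)
    assume "\<gamma> s' \<noteq> \<gamma> s"
    from roll[OF this] show False using norm_A by (simp add: C_def r_def)
  qed
  hence "cis \<theta> = cis \<theta>'" using A \<open>C' = C\<close> vv v0 r by simp
  thus ?thesis using \<open>C' = C\<close> vv by (simp add: larmor_point_eq n mult.assoc[symmetric] flip: C_def C'_def)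
qed

lemma outside_if_not_region: "P \<notin> region \<Longrightarrow> P \<in> outside (range \<gamma>)"
  by (metis ComplI Un_iff inside_Un_outside)

text \<open>The parallel curve has velocity (1 - 2 \<kappa> / \<beta>) \<tau>, and P is strictly on
  one side of all its tangent lines. As the factor has constant sign, the curve turns around P in
  one direction only; the winding number is nonzero and P is not in the outside.\<close>

lemma larmor_point_in_parallel_curve:
  assumes \<beta>: "\<beta> > 0"
    and neg: "\<And>s'. (P - parallel_curve \<gamma> (2 * (1 / \<beta>)) s') \<bullet> (\<i> * \<tau> s') < 0"
    and sgn: "(\<forall>s. 1 - 2 * (1 / \<beta>) * \<kappa> s > 0) \<or> (\<forall>s. 1 - 2 * (1 / \<beta>) * \<kappa> s < 0)"
  shows "P \<in> inside (range (parallel_curve \<gamma> (2 * (1 / \<beta>))))"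
proof -
  define G where "G = parallel_curve \<gamma> (2 * (1 / \<beta>))"
  define j where "j s = 1 - 2 * (1 / \<beta>) * \<kappa> s" for s
  have G': "(G has_vector_derivative of_real (j t) * \<tau> t) (at t)" for t
  proof -
    have "(G has_vector_derivative \<tau> t + of_real (2 * (1 / \<beta>)) * \<i> * (of_real (\<kappa> t) * (\<i> * \<tau> t))) (at t)"
      unfolding G_def parallel_curve_def[abs_def]
      by (intro has_vector_derivative_add has_vector_derivative_mult_right \<gamma>_deriv frenet)
    moreover have "\<tau> t + of_real (2 * (1 / \<beta>)) * \<i> * (of_real (\<kappa> t) * (\<i> * \<tau> t)) = of_real (j t) * \<tau> t"
    proof -
      have "\<i> * (c * (\<i> * z)) = - (c * z)" for c z :: complex
        by (simp add: complex_eq_iff algebra_simps)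
      thus ?thesis by (simp add: j_def algebra_simps)
    qed
    ultimately show ?thesis by simp
  qed
  define g where "g = unit_interval_loop G L"
  define g' where "g' t = of_real L * (of_real (j (L * t)) * \<tau> (L * t))" for t
  have g: "(g has_vector_derivative g' t) (at t)" for t
  proof -
    have "((\<lambda>t. L * t) has_vector_derivative L) (at t)" by (auto intro!: derivative_eq_intros)
    from vector_diff_chain_at[OF this G'] show ?thesis
      by (simp add: o_def g_def g'_def unit_interval_loop_def scaleR_conv_of_real)
  qed
  have cg: "continuous_on UNIV g'"
    unfolding g'_def[abs_def] j_def
    by (intro continuous_intros continuous_on_compose2[OF continuous_\<tau>[of UNIV]] continuous_on_compose2[OF continuous_\<kappa>[of UNIV]]) auto
  have per: "G (t + L) = G t" for t
    by (simp add: G_def parallel_curve_def periodic tangent_periodic)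
  have img: "path_image g = range G" unfolding g_def by (rule range_unit_interval_loop) (rule per)
  have closed: "pathfinish g = pathstart g"
    using per[of 0] by (simp add: pathfinish_def pathstart_def g_def unit_interval_loop_def)
  have Im: "Im (g' t * cnj (g t - P)) = L * j (L * t) * ((P - G (L * t)) \<bullet> (\<i> * \<tau> (L * t)))" for t
    by (simp add: g'_def g_def unit_interval_loop_def inner_complex_def algebra_simps)
  have "P \<notin> path_image g \<and> Re (winding_number g P) \<noteq> 0"
    using sgn
  proof
    assume "\<forall>s. 1 - 2 * (1 / \<beta>) * \<kappa> s > 0"
    hence "Im (g' t * cnj (g t - P)) < 0" for t
      unfolding Im using neg[of "L * t"] L_pos by (simp add: mult_pos_neg G_def j_def)
    from winding_number_sign_neg[OF g cg this] show ?thesis by simp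
  next
    assume "\<forall>s. 1 - 2 * (1 / \<beta>) * \<kappa> s < 0"
    hence "Im (g' t * cnj (g t - P)) > 0" for t
      unfolding Im using neg[of "L * t"] L_pos by (simp add: mult_neg_neg mult_pos_neg G_def j_def)
    from winding_number_sign_pos[OF g cg this] show ?thesis by simp
  qed
  moreover have "path g" unfolding path_def
    using g by (meson continuous_at_imp_continuous_on has_vector_derivative_continuous)
  ultimately have "P \<notin> path_image g" "P \<notin> outside (path_image g)"
    using winding_number_zero_in_outside[OF _ closed] by auto
  thus ?thesis unfolding img G_def[symmetric] by (metis ComplI Un_iff inside_Un_outside)
qed

lemma billiard_evenness:
  assumes \<beta>: "\<beta> \<in> admissible_fields \<gamma> L" and inv: "invariant_function \<gamma> \<beta> F"
    and \<theta>: "0 < \<theta>" "\<theta> < pi"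
  shows "F (larmor_point \<gamma> \<beta> s \<theta>) = F (larmor_point \<gamma> \<beta> s (- \<theta>))"
proof -
  have \<beta>0: "\<beta> > 0" using \<beta> by (simp add: admissible_fields_def)
  define r where "r = 1 / \<beta>"
  have r: "r > 0" using \<beta>0 by (simp add: r_def)
  define P where "P = larmor_point \<gamma> \<beta> s (- \<theta>)"
  define C where "C = larmor_center \<gamma> \<beta> s"
  define n where "n = \<i> * \<tau> s"
  have nn: "n \<bullet> n = 1" "norm n = 1" by (simp_all add: n_def norm_mult inner_tangent)
  have cos1: "cos \<theta> < 1" using \<theta> cos_monotone_0_pi[of 0 \<theta>] by simp
  have PC: "P - C = - (of_real r * (cis (- \<theta>) * n))" by (simp add: P_def C_def larmor_point_eq r_def n_def)
  have norm_PC: "norm (P - C) = r" using r by (simp add: PC norm_mult nn)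
  have P\<gamma>: "P - \<gamma> s = of_real r * ((1 - cis (- \<theta>)) * n)"
    by (simp add: P_def larmor_point_eq larmor_center_eq r_def n_def algebra_simps)
  \<comment> \<open>Because \<theta> < pi, the chord is shorter than the diameter; this strictness
    keeps P off the parallel curve.\<close>
  have norm_P\<gamma>: "norm (P - \<gamma> s) < 2 * r"
  proof -
    have "(norm (1 - cis (- \<theta>)))\<^sup>2 = (1 - cos \<theta>)\<^sup>2 + (sin \<theta>)\<^sup>2" by (simp add: cmod_power2)
    also have "\<dots> = 2 - 2 * cos \<theta>" by (simp add: sin_squared_eq power2_eq_square algebra_simps)
    also have "\<dots> < 2\<^sup>2" using \<theta> cos_monotone_0_pi[of \<theta> pi] by simp
    finally have "norm (1 - cis (- \<theta>)) < 2" by (rule power2_less_imp_less) simp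
    thus ?thesis using r by (simp add: P\<gamma> norm_mult nn)
  qed
  have P\<gamma>0: "P \<noteq> \<gamma> s"
  proof
    assume "P = \<gamma> s"
    hence "r * ((1 - cis (- \<theta>)) * n) = 0" using P\<gamma> by simp
    hence "cis (- \<theta>) = 1" using r nn(2) by auto
    hence "Re (cis (- \<theta>)) = 1" by (simp only: one_complex.sel)
    thus False using cos1 by simp
  qed
  have cs: "z \<bullet> (\<i> * \<tau> t) \<le> norm z" for z t
    using norm_cauchy_schwarz[of z "\<i> * \<tau> t"] by (simp add: norm_mult)
  have par: "P - parallel_curve \<gamma> (2 * (1 / \<beta>)) t = (P - \<gamma> s) + (\<gamma> s - \<gamma> t) - (2 * r) *\<^sub>R (\<i> * \<tau> t)" for t
    by (simp add: parallel_curve_def r_def scaleR_conv_of_real)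
  have "P \<in> billiard_annulus \<gamma> \<beta> \<and> (\<forall>s' \<theta>'. 0 < \<theta>' \<longrightarrow> \<theta>' < pi \<longrightarrow> P = larmor_point \<gamma> \<beta> s' (- \<theta>') \<longrightarrow>
      larmor_point \<gamma> \<beta> s \<theta> = larmor_point \<gamma> \<beta> s' \<theta>')"
  proof (cases "clockwise \<gamma> L")
    case True
    obtain \<sigma> :: real where "\<sigma> = -1"
      and "\<And>z s. z \<in> region \<Longrightarrow> 0 \<le> \<sigma> * ((z - \<gamma> s) \<bullet> (\<i> * \<tau> s))"
      using support_sign True by metis
    hence sup: "(z - \<gamma> s) \<bullet> (\<i> * \<tau> s) \<le> 0" if "z \<in> region" for z s
      using that by fastforce
    have \<kappa>: "\<kappa> t \<le> 0" for t using curvature_sign[of "-1" t] sup by simp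
    \<comment> \<open>P is strictly to the left of the tangent at s, where the region has no
      points.\<close>
    have "(P - \<gamma> s) \<bullet> n = r * (1 - cos \<theta>)"
    proof -
      have "(P - \<gamma> s) \<bullet> n = (r *\<^sub>R ((1 - cis (- \<theta>)) * n)) \<bullet> n" by (simp only: P\<gamma> scaleR_conv_of_real)
      also have "\<dots> = r * ((cis 0 * n) \<bullet> (cis 0 * n) - (cis (- \<theta>) * n) \<bullet> (cis 0 * n))"
        by (simp add: algebra_simps inner_diff_left)
      finally show ?thesis unfolding cis_inner by (simp add: nn)
    qed
    hence "(P - \<gamma> s) \<bullet> n > 0" using r cos1 by simp
    hence "P \<notin> region" using sup[of P s] by (auto simp: n_def)
    hence out: "P \<in> outside (range \<gamma>)" by (rule outside_if_not_region)
    have "P \<in> inside (range (parallel_curve \<gamma> (2 * (1 / \<beta>))))"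
    proof (rule larmor_point_in_parallel_curve[OF \<beta>0])
      show "(P - parallel_curve \<gamma> (2 * (1 / \<beta>)) t) \<bullet> (\<i> * \<tau> t) < 0" for t
        using cs[of "P - \<gamma> s" t] sup[of "\<gamma> s" t] norm_P\<gamma> unfolding par
        by (simp add: inner_diff_left inner_add_left inner_tangent)
      have "2 * (1 / \<beta>) * \<kappa> t \<le> 0" for t using \<kappa>[of t] \<beta>0 by (simp add: divide_le_0_iff)
      thus "(\<forall>s. 1 - 2 * (1 / \<beta>) * \<kappa> s > 0) \<or> (\<forall>s. 1 - 2 * (1 / \<beta>) * \<kappa> s < 0)"
        by (smt (verit))
    qed
    thus ?thesis using out larmor_point_unique_exterior[OF sup \<beta>0 \<theta>, of _ s] unfolding billiard_annulus_def P_def by blast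
  next
    case False
    hence ccw: "counterclockwise \<gamma> L" and \<beta>min: "\<beta> < min_curvature \<gamma>" using \<beta> by (auto simp: admissible_fields_def)
    obtain \<sigma> :: real where "\<sigma> = 1"
      and "\<And>z s. z \<in> region \<Longrightarrow> 0 \<le> \<sigma> * ((z - \<gamma> s) \<bullet> (\<i> * \<tau> s))"
      using support_sign ccw by metis
    hence sup: "0 \<le> (z - \<gamma> s) \<bullet> (\<i> * \<tau> s)" if "z \<in> region" for z s
      using that by fastforce
    have \<kappa>: "\<beta> < \<kappa> t" for t
    proof -
      have "bdd_below (range (curvature \<gamma>))" by (rule bdd_belowI[of _ 0]) (auto simp: curvature_def)
      hence "min_curvature \<gamma> \<le> curvature \<gamma> t" unfolding min_curvature_def by (rule cINF_lower) simp
      moreover have "\<kappa> t \<ge> 0" using curvature_sign[of 1 t] sup by simp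
      ultimately show ?thesis using \<beta>min curvature_eq[of t] by simp
    qed
    have roll: "norm (\<gamma> s' - larmor_center \<gamma> \<beta> s) < 1 / \<beta>" if "\<gamma> s' \<noteq> \<gamma> s" for s s'
      by (rule rolling[OF sup \<beta>0 \<kappa> that])
    have ran: "range \<gamma> \<subseteq> cball C r"
    proof
      fix z assume "z \<in> range \<gamma>"
      then obtain t where z: "z = \<gamma> t" by auto
      show "z \<in> cball C r"
      proof (cases "\<gamma> t = \<gamma> s")
        case True
        have "\<gamma> s - C = - (of_real r * n)" by (simp add: C_def larmor_center_eq n_def r_def)
        thus ?thesis using True r by (simp add: z dist_norm norm_minus_commute[of C] norm_mult nn)
      next
        case False
        from roll[OF this] show ?thesis by (simp add: z dist_norm norm_minus_commute[of "larmor_center \<gamma> \<beta> s"] C_def r_def)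
      qed
    qed
    \<comment> \<open>The convex disc contains the curve and so its inside, which is open and hence
      misses the bounding circle, where P lies.\<close>
    have "inside (range \<gamma>) \<subseteq> ball C r"
    proof -
      have "- cball C r \<subseteq> outside (range \<gamma>)" by (rule outside_subset_convex[OF convex_cball ran])
      hence "inside (range \<gamma>) \<subseteq> cball C r" using inside_Int_outside[of "range \<gamma>"] by blast
      hence "inside (range \<gamma>) \<subseteq> interior (cball C r)" using Jordan by (intro interior_maximal) auto
      thus ?thesis by simp
    qed
    moreover have "P \<notin> ball C r" using norm_PC by (simp add: dist_norm norm_minus_commute)
    moreover have "P \<notin> range \<gamma>"
    proof
      assume "P \<in> range \<gamma>"
      then obtain t where t: "P = \<gamma> t" by auto
      hence "\<gamma> t \<noteq> \<gamma> s" using P\<gamma>0 by simp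
      from roll[OF this] show False using norm_PC t by (simp add: C_def r_def)
    qed
    ultimately have "P \<notin> region" by auto
    hence out: "P \<in> outside (range \<gamma>)" by (rule outside_if_not_region)
    have "P \<in> inside (range (parallel_curve \<gamma> (2 * (1 / \<beta>))))"
    proof (rule larmor_point_in_parallel_curve[OF \<beta>0])
      show "(P - parallel_curve \<gamma> (2 * (1 / \<beta>)) t) \<bullet> (\<i> * \<tau> t) < 0" for t
      proof (cases "\<gamma> t = \<gamma> s")
        case True
        thus ?thesis using cs[of "P - \<gamma> s" t] norm_P\<gamma> unfolding par
          by (simp add: inner_diff_left inner_tangent)
      next
        case False
        define m where "m = \<i> * \<tau> t"
        \<comment> \<open>D joins the Larmor centres for t and s. As \<gamma> t is in the open disc
          for s, |D + r m| < r and so D has a negative component along m; this makes the final bound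
          strict even when P - C has component r.\<close>
        define D where "D = C - larmor_center \<gamma> \<beta> t"
        have m: "m \<bullet> m = 1" by (simp add: m_def inner_tangent)
        have CD: "C - \<gamma> t = D + r *\<^sub>R m"
          by (simp add: D_def m_def larmor_center_eq[of _ t] r_def scaleR_conv_of_real)
        have "norm (C - \<gamma> t) < r" using roll[OF False] unfolding C_def r_def by (subst norm_minus_commute)
        hence "norm (D + r *\<^sub>R m) < r" unfolding CD .
        hence "(norm (D + r *\<^sub>R m))\<^sup>2 < r\<^sup>2" by (simp add: power_strict_mono)
        also have "(norm (D + r *\<^sub>R m))\<^sup>2 = D \<bullet> D + 2 * r * (D \<bullet> m) + r\<^sup>2"
          unfolding power2_norm_eq_inner
          by (simp add: inner_add_left inner_add_right m inner_commute[of m D] power2_eq_square ring_distribs)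
        finally have "2 * r * (D \<bullet> m) < 0" using inner_ge_zero[of D] by linarith
        hence "D \<bullet> m < 0" using r by (simp add: mult_less_0_iff)
        moreover have "(P - C) \<bullet> m \<le> r" using cs[of "P - C" t] norm_PC by (simp add: m_def)
        moreover have P: "P - parallel_curve \<gamma> (2 * (1 / \<beta>)) t = (P - C) + D - r *\<^sub>R m"
          by (simp add: D_def m_def larmor_center_eq[of _ t] parallel_curve_def r_def scaleR_conv_of_real)
        moreover have "(P - parallel_curve \<gamma> (2 * (1 / \<beta>)) t) \<bullet> m = (P - C) \<bullet> m + D \<bullet> m - r"
          unfolding P inner_diff_left[of _ "r *\<^sub>R m"] inner_add_left by (simp add: m)
        ultimately show ?thesis unfolding m_def[symmetric] by linarith
      qed
      have "2 * (1 / \<beta>) * \<kappa> t > 1" for t using \<kappa>[of t] \<beta>0 by (simp add: field_simps)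
      thus "(\<forall>s. 1 - 2 * (1 / \<beta>) * \<kappa> s > 0) \<or> (\<forall>s. 1 - 2 * (1 / \<beta>) * \<kappa> s < 0)"
        by (smt (verit))
    qed
    thus ?thesis using out larmor_point_unique_interior[OF roll \<beta>0 \<theta>, of _ s] unfolding billiard_annulus_def P_def by blast
  qed
  hence ann: "P \<in> billiard_annulus \<gamma> \<beta>"
    and uniq: "\<And>s' \<theta>'. 0 < \<theta>' \<Longrightarrow> \<theta>' < pi \<Longrightarrow> P = larmor_point \<gamma> \<beta> s' (- \<theta>') \<Longrightarrow>
      larmor_point \<gamma> \<beta> s' \<theta>' = larmor_point \<gamma> \<beta> s \<theta>" by auto
  have "outer_billiard_map \<gamma> \<beta> P = larmor_point \<gamma> \<beta> s \<theta>"
    unfolding outer_billiard_map_def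
  proof (rule the_equality)
    show "\<exists>s' \<theta>'. 0 < \<theta>' \<and> \<theta>' < pi \<and> P = larmor_point \<gamma> \<beta> s' (- \<theta>') \<and>
        larmor_point \<gamma> \<beta> s \<theta> = larmor_point \<gamma> \<beta> s' \<theta>'" using \<theta> P_def by blast
    show "Q = larmor_point \<gamma> \<beta> s \<theta>" if "\<exists>s' \<theta>'. 0 < \<theta>' \<and> \<theta>' < pi \<and> P = larmor_point \<gamma> \<beta> s' (- \<theta>') \<and>
        Q = larmor_point \<gamma> \<beta> s' \<theta>'" for Q using that uniq by blast
  qed
  thus ?thesis using inv ann unfolding invariant_function_def P_def by metis
qed

lemma larmor_point_circle:
  "Re (larmor_point \<gamma> \<beta> s t) = circle_x (1 / \<beta>) (Re (\<gamma> s)) (Re (\<tau> s)) (Im (\<tau> s)) t"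
  "Im (larmor_point \<gamma> \<beta> s t) = circle_y (1 / \<beta>) (Im (\<gamma> s)) (Re (\<tau> s)) (Im (\<tau> s)) t"
  unfolding larmor_point_eq larmor_center_eq circle_x_def circle_y_def
  by (simp_all add: algebra_simps Re_divide_of_real Im_divide_of_real diff_divide_distrib add_divide_distrib)

lemma unit_speed_arc_coordinates:
  assumes "a < b" "\<And>s. (\<kappa> has_real_derivative \<kappa>' s) (at s)"
  shows "unit_speed_arc (\<lambda>s. Re (\<gamma> s)) (\<lambda>s. Im (\<gamma> s)) (\<lambda>s. Re (\<tau> s)) (\<lambda>s. Im (\<tau> s)) \<kappa> \<kappa>' a b"
proof unfold_locales
  fix s
  show "((\<lambda>s. Re (\<gamma> s)) has_real_derivative Re (\<tau> s)) (at s)" "((\<lambda>s. Im (\<gamma> s)) has_real_derivative Im (\<tau> s)) (at s)"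
    using has_vector_derivative_inner_right[OF \<gamma>_deriv[of s], of 1]
      has_vector_derivative_inner_right[OF \<gamma>_deriv[of s], of \<i>] by (simp_all add: inner_complex_def)
  show "((\<lambda>s. Re (\<tau> s)) has_real_derivative - (\<kappa> s * Im (\<tau> s))) (at s)"
    "((\<lambda>s. Im (\<tau> s)) has_real_derivative \<kappa> s * Re (\<tau> s)) (at s)"
    using has_vector_derivative_inner_right[OF frenet[of s], of 1]
      has_vector_derivative_inner_right[OF frenet[of s], of \<i>] by (simp_all add: inner_complex_def)
  show "(Re (\<tau> s))\<^sup>2 + (Im (\<tau> s))\<^sup>2 = 1" by (simp flip: cmod_power2)
qed (use assms in auto)

section \<open>Infinitely many integrable fields force a circle\<close>

text \<open>Near a point with \<kappa>' nonzero there is a subarc on which Re \<tau> is nonzero as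
  well, and the finiteness theorem for arcs applies to it.\<close>

lemma curvature_derivative_zero:
  assumes inf: "infinite {\<beta> \<in> admissible_fields \<gamma> L. algebraically_integrable \<gamma> \<beta>}"
    and \<kappa>': "continuous_on UNIV \<kappa>'" "\<And>s. (\<kappa> has_real_derivative \<kappa>' s) (at s)"
  shows "\<kappa>' s = 0"
proof (rule ccontr)
  assume "\<kappa>' s \<noteq> 0"
  have nbhd: "\<exists>e>0. \<forall>t\<in>{s - e<..<s + e}. h t \<noteq> 0"
    if "continuous_on UNIV h" "h s \<noteq> 0" for h :: "real \<Rightarrow> real" and s
  proof -
    have "isCont h s" using that(1) by (simp add: continuous_on_eq_continuous_at)
    hence "\<forall>\<^sub>F t in nhds s. h t \<noteq> 0"
      using that(2) by (simp add: isCont_def tendsto_imp_eventually_ne eventually_nhds_conv_at)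
    then obtain e where "e > 0" "\<And>t. dist t s < e \<Longrightarrow> h t \<noteq> 0" unfolding eventually_nhds_metric by blast
    thus ?thesis by (intro exI[of _ e]) (auto simp: dist_real_def)
  qed
  obtain e where e: "e > 0" "\<And>t. t \<in> {s - e<..<s + e} \<Longrightarrow> \<kappa>' t \<noteq> 0"
    using nbhd[OF \<kappa>'(1) \<open>\<kappa>' s \<noteq> 0\<close>] by blast
  interpret A: unit_speed_arc "\<lambda>s. Re (\<gamma> s)" "\<lambda>s. Im (\<gamma> s)" "\<lambda>s. Re (\<tau> s)" "\<lambda>s. Im (\<tau> s)" \<kappa> \<kappa>' "s - e" "s + e"
    by (rule unit_speed_arc_coordinates) (use e \<kappa>' in auto)
  \<comment> \<open>A tangent vertical throughout would make the piece straight, with \<kappa> = 0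
    and therefore \<kappa>' = 0.\<close>
  have "\<exists>t\<in>{s - e<..<s + e}. Re (\<tau> t) \<noteq> 0"
  proof (rule ccontr)
    assume "\<not> ?thesis"
    hence z: "Re (\<tau> t) = 0" if "t \<in> {s - e<..<s + e}" for t using that by blast
    have k: "\<kappa> t = 0" if t: "t \<in> {s - e<..<s + e}" for t
    proof -
      have "- (\<kappa> t * Im (\<tau> t)) = 0" by (rule DERIV_zero_on_interval[OF A.c'[OF t] t z])
      moreover have "Im (\<tau> t) \<noteq> 0" using A.cd[OF t] z[OF t] by auto
      ultimately show ?thesis by simp
    qed
    have "s \<in> {s - e<..<s + e}" using e(1) by simp
    from DERIV_zero_on_interval[OF \<kappa>'(2) this k] e(2)[OF this] show False by simp
  qed
  then obtain t where t: "t \<in> {s - e<..<s + e}" "Re (\<tau> t) \<noteq> 0" by blast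
  have "continuous_on UNIV (\<lambda>t. Re (\<tau> t))" by (intro continuous_intros continuous_\<tau>)
  from nbhd[OF this t(2)] obtain d where d: "d > 0" "\<And>u. u \<in> {t - d<..<t + d} \<Longrightarrow> Re (\<tau> u) \<noteq> 0" by blast
  define a b where "a = max (s - e) (t - d)" and "b = min (s + e) (t + d)"
  have ab: "a < b" using t(1) d(1) by (auto simp: a_def b_def)
  interpret B: unit_speed_arc "\<lambda>s. Re (\<gamma> s)" "\<lambda>s. Im (\<gamma> s)" "\<lambda>s. Re (\<tau> s)" "\<lambda>s. Im (\<tau> s)" \<kappa> \<kappa>' a b
    by (rule unit_speed_arc_coordinates[OF ab \<kappa>'(2)])
  show False
  proof (rule B.finitely_many_even_fields[OF inf])
    show "0 \<notin> {\<beta> \<in> admissible_fields \<gamma> L. algebraically_integrable \<gamma> \<beta>}"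
      by (simp add: admissible_fields_def)
    show "Re (\<tau> u) \<noteq> 0" if "u \<in> {a<..<b}" for u using that d(2) by (auto simp: a_def b_def)
    show "\<kappa>' u \<noteq> 0" if "u \<in> {a<..<b}" for u using that e(2) by (auto simp: a_def b_def)
    fix \<beta> assume "\<beta> \<in> {\<beta> \<in> admissible_fields \<gamma> L. algebraically_integrable \<gamma> \<beta>}"
    then obtain F where \<beta>: "\<beta> \<in> admissible_fields \<gamma> L" and F: "real_polynomial_function F"
      "\<not> F constant_on UNIV" "invariant_function \<gamma> \<beta> F" unfolding algebraically_integrable_def by blast
    obtain h where h: "\<And>z. F z = eval2 h (Re z) (Im z)" using eval2_of_real_polynomial_function[OF F(1)] by blast
    have "h \<noteq> [:[:C:]:]" for C
    proof
      assume "h = [:[:C:]:]"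
      hence "F z = C" for z by (simp add: h)
      thus False using F(2) unfolding constant_on_def by blast
    qed
    moreover have "even_on_circle h (1 / \<beta>) (Re (\<gamma> u)) (Im (\<gamma> u)) (Re (\<tau> u)) (Im (\<tau> u))" for u
      unfolding even_on_circle_def
      using billiard_evenness[OF \<beta> F(3), of _ u] by (auto simp: h larmor_point_circle)
    ultimately show "\<exists>h. (\<forall>C. h \<noteq> [:[:C:]:]) \<and>
      (\<forall>s\<in>{a<..<b}. even_on_circle h (1 / \<beta>) (Re (\<gamma> s)) (Im (\<gamma> s)) (Re (\<tau> s)) (Im (\<tau> s)))" by blast
  qed
qed

text \<open>Zero curvature would give a straight line, which is not periodic. Otherwise \<gamma> +
  (\<i> / c) \<tau> is a fixed centre, and \<tau> rotates at the constant rate c, so every point of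
  the circle is reached.\<close>

lemma constant_curvature_imp_circle:
  assumes \<kappa>: "\<And>s. \<kappa> s = c"
  shows "\<exists>z \<rho>. range \<gamma> = sphere z \<rho>"
proof (cases "c = 0")
  case True
  hence "(\<tau> has_vector_derivative 0) (at t within UNIV)" for t using frenet[of t] by (simp add: \<kappa>)
  then obtain w where w: "\<And>t. \<tau> t = w"
    using has_vector_derivative_zero_constant[of UNIV \<tau>] by (metis UNIV_I convex_UNIV)
  have "((\<lambda>t. \<gamma> t - t *\<^sub>R w) has_vector_derivative \<tau> t - 1 *\<^sub>R w) (at t)" for t
    by (intro has_vector_derivative_diff \<gamma>_deriv) (auto intro!: derivative_eq_intros)
  hence "((\<lambda>t. \<gamma> t - t *\<^sub>R w) has_vector_derivative 0) (at t within UNIV)" for t by (simp add: w)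
  then obtain p where p: "\<And>t. \<gamma> t - t *\<^sub>R w = p"
    using has_vector_derivative_zero_constant[of UNIV "\<lambda>t. \<gamma> t - t *\<^sub>R w"] by (metis UNIV_I convex_UNIV)
  have "L *\<^sub>R w = 0" using p[of L] p[of 0] periodic[of 0] by simp
  hence "w = 0" using L_pos by simp
  thus ?thesis using norm_tangent[of 0] w by simp
next
  case False
  have "((\<lambda>t. \<gamma> t + \<i> / of_real c * \<tau> t) has_vector_derivative \<tau> t + \<i> / of_real c * (of_real (\<kappa> t) * (\<i> * \<tau> t))) (at t)" for t
    by (intro has_vector_derivative_add has_vector_derivative_mult_right \<gamma>_deriv frenet)
  moreover have "\<tau> t + \<i> / of_real c * (of_real (\<kappa> t) * (\<i> * \<tau> t)) = 0" for t
    using False by (simp add: \<kappa> mult.assoc[symmetric])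
  ultimately have "((\<lambda>t. \<gamma> t + \<i> / of_real c * \<tau> t) has_vector_derivative 0) (at t within UNIV)" for t by simp
  then obtain z where z: "\<And>t. \<gamma> t + \<i> / of_real c * \<tau> t = z"
    using has_vector_derivative_zero_constant[of UNIV "\<lambda>t. \<gamma> t + \<i> / of_real c * \<tau> t"] by (metis UNIV_I convex_UNIV)
  have cis': "((\<lambda>t. cis (- (c * t))) has_vector_derivative - (\<i> * of_real c * cis (- (c * t)))) (at t)" for t
  proof -
    have "((\<lambda>z. exp (- (\<i> * (of_real c * z)))) has_field_derivative
        - (\<i> * of_real c * exp (- (\<i> * (of_real c * of_real t))))) (at (of_real t))"
      by (auto intro!: derivative_eq_intros)
    from has_vector_derivative_real_field[OF this] show ?thesis by (simp add: cis_conv_exp)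
  qed
  have "((\<lambda>t. \<tau> t * cis (- (c * t))) has_vector_derivative 0) (at t within UNIV)" for t
    using has_vector_derivative_mult[OF frenet cis', of t] by (simp add: \<kappa> algebra_simps)
  then obtain w where w: "\<And>t. \<tau> t * cis (- (c * t)) = w"
    using has_vector_derivative_zero_constant[of UNIV "\<lambda>t. \<tau> t * cis (- (c * t))"] by (metis UNIV_I convex_UNIV)
  have nw: "norm w = 1" by (simp add: norm_mult flip: w[of 0])
  have \<tau>: "\<tau> t = w * cis (c * t)" for t by (simp add: mult.assoc cis_mult flip: w[of t])
  have \<gamma>: "\<gamma> t = z - \<i> / of_real c * \<tau> t" for t by (simp flip: z[of t])
  have "range \<gamma> = sphere z (1 / \<bar>c\<bar>)"
  proof
    show "range \<gamma> \<subseteq> sphere z (1 / \<bar>c\<bar>)" by (auto simp: \<gamma> dist_norm norm_mult norm_divide)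
    show "sphere z (1 / \<bar>c\<bar>) \<subseteq> range \<gamma>"
    proof
      fix p assume "p \<in> sphere z (1 / \<bar>c\<bar>)"
      hence p: "norm (z - p) = 1 / \<bar>c\<bar>" by (simp add: dist_norm)
      \<comment> \<open>The value that cis (c t) must take, up to the factor w in \<tau>, for
        \<gamma> t to equal p.\<close>
      define v where "v = (z - p) * of_real c / (\<i> * w)"
      have "norm v = 1" using p False by (simp add: v_def norm_mult norm_divide nw)
      hence "cis (Arg v) = v"
        using cis_Arg[of v] by (metis div_by_1 norm_zero of_real_1 sgn_eq zero_neq_one)
      hence "\<tau> (Arg v / c) = (z - p) * of_real c / \<i>" using False nw by (auto simp: \<tau> v_def)
      hence "\<gamma> (Arg v / c) = p" using False by (simp add: \<gamma>)
      thus "p \<in> range \<gamma>" by (metis rangeI)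
    qed
  qed
  thus ?thesis by blast
qed

end

theorem corollary1p11:
  fixes \<gamma> :: "real \<Rightarrow> complex" and L :: real
  assumes "smooth_closed_convex_curve \<gamma> L"
    and "\<not> (\<exists>c \<rho>. range \<gamma> = sphere c \<rho>)"
  shows "finite {\<beta> \<in> admissible_fields \<gamma> L. algebraically_integrable \<gamma> \<beta>}"
proof (rule ccontr)
  assume inf: "infinite {\<beta> \<in> admissible_fields \<gamma> L. algebraically_integrable \<gamma> \<beta>}"
  interpret smooth_convex_loop \<gamma> L by unfold_locales (rule assms(1))
  obtain \<kappa>' where \<kappa>': "continuous_on UNIV \<kappa>'" "\<And>s. (signed_curvature \<gamma> has_real_derivative \<kappa>' s) (at s)"
    using \<kappa>_smooth by blast
  have "(signed_curvature \<gamma> has_real_derivative 0) (at s)" for s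
    using \<kappa>'(2)[of s] curvature_derivative_zero[OF inf \<kappa>'] by simp
  hence "signed_curvature \<gamma> s = signed_curvature \<gamma> 0" for s
    by (rule DERIV_isconst_all[OF allI])
  from constant_curvature_imp_circle[OF this] assms(2) show False by blast
qed

end
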